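(* Let $\mathfrak g$ be a finite-dimensional real unimodular solvable Lie algebra whose nilradical $\mathfrak n$ is abelian. Then there exists an inner product on $\mathfrak g$ having a geodesic basis.
   Context: For an inner product $\langle\cdot,\cdot\rangle$ on a real Lie algebra $\mathfrak g$, a nonzero $X\in\mathfrak g$ is a geodesic element if $\langle X,[X,Y]\rangle=0$ for all $Y\in\mathfrak g$. A basis of $\mathfrak g$ is a geodesic basis (for that inner product) if each of its elements is a geodesic element. A Lie algebra is unimodular if $\operatorname{Tr}(\operatorname{ad}(X))=0$ for all $X\in\mathfrak g$. The nilradical is the maximal nilpotent ideal. *)

theory Defs
  imports "HOL-Analysis.Analysis"
begin

text \<open>A finite-dimensional real Lie algebra is modelled as a bracket on the
  underlying finite-dimensional real vector space of a type of class
  euclidean_space (its built-in inner product is only used to compute traces;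
  the inner products of the theorem are arbitrary).\<close>

definition lie_algebra :: "('a::euclidean_space \<Rightarrow> 'a \<Rightarrow> 'a) \<Rightarrow> bool" where
  "lie_algebra br \<longleftrightarrow> bilinear br \<and> (\<forall>x. br x x = 0) \<and>
     (\<forall>x y z. br x (br y z) + br y (br z x) + br z (br x y) = 0)"

definition trace_map :: "('a::euclidean_space \<Rightarrow> 'a) \<Rightarrow> real" where
  "trace_map f = (\<Sum>b\<in>Basis. f b \<bullet> b)"

definition unimodular :: "('a::euclidean_space \<Rightarrow> 'a \<Rightarrow> 'a) \<Rightarrow> bool" where
  "unimodular br \<longleftrightarrow> (\<forall>X. trace_map (br X) = 0)"

definition bracket_span :: "('a::euclidean_space \<Rightarrow> 'a \<Rightarrow> 'a) \<Rightarrow> 'a set \<Rightarrow> 'a set \<Rightarrow> 'a set" where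
  "bracket_span br S T = span {br x y | x y. x \<in> S \<and> y \<in> T}"

fun derived_series :: "('a::euclidean_space \<Rightarrow> 'a \<Rightarrow> 'a) \<Rightarrow> nat \<Rightarrow> 'a set" where
  "derived_series br 0 = UNIV"
| "derived_series br (Suc n) = bracket_span br (derived_series br n) (derived_series br n)"

definition solvable_lie :: "('a::euclidean_space \<Rightarrow> 'a \<Rightarrow> 'a) \<Rightarrow> bool" where
  "solvable_lie br \<longleftrightarrow> (\<exists>n. derived_series br n = {0})"

definition lie_ideal :: "('a::euclidean_space \<Rightarrow> 'a \<Rightarrow> 'a) \<Rightarrow> 'a set \<Rightarrow> bool" where
  "lie_ideal br I \<longleftrightarrow> subspace I \<and> (\<forall>x y. y \<in> I \<longrightarrow> br x y \<in> I)"

fun lower_central :: "('a::euclidean_space \<Rightarrow> 'a \<Rightarrow> 'a) \<Rightarrow> 'a set \<Rightarrow> nat \<Rightarrow> 'a set" where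
  "lower_central br I 0 = I"
| "lower_central br I (Suc n) = bracket_span br I (lower_central br I n)"

definition nilpotent_sub :: "('a::euclidean_space \<Rightarrow> 'a \<Rightarrow> 'a) \<Rightarrow> 'a set \<Rightarrow> bool" where
  "nilpotent_sub br I \<longleftrightarrow> (\<exists>n. lower_central br I n = {0})"

definition is_nilradical :: "('a::euclidean_space \<Rightarrow> 'a \<Rightarrow> 'a) \<Rightarrow> 'a set \<Rightarrow> bool" where
  "is_nilradical br N \<longleftrightarrow> lie_ideal br N \<and> nilpotent_sub br N \<and>
     (\<forall>M. lie_ideal br M \<and> nilpotent_sub br M \<longrightarrow> M \<subseteq> N)"

definition abelian_sub :: "('a::euclidean_space \<Rightarrow> 'a \<Rightarrow> 'a) \<Rightarrow> 'a set \<Rightarrow> bool" where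
  "abelian_sub br N \<longleftrightarrow> (\<forall>x\<in>N. \<forall>y\<in>N. br x y = 0)"

definition inner_product_on :: "('a::euclidean_space \<Rightarrow> 'a \<Rightarrow> real) \<Rightarrow> bool" where
  "inner_product_on ip \<longleftrightarrow> bilinear ip \<and> (\<forall>x y. ip x y = ip y x) \<and>
     (\<forall>x. x \<noteq> 0 \<longrightarrow> ip x x > 0)"

definition geodesic_element ::
  "('a::euclidean_space \<Rightarrow> 'a \<Rightarrow> real) \<Rightarrow> ('a \<Rightarrow> 'a \<Rightarrow> 'a) \<Rightarrow> 'a \<Rightarrow> bool" where
  "geodesic_element ip br X \<longleftrightarrow> X \<noteq> 0 \<and> (\<forall>Y. ip X (br X Y) = 0)"

definition geodesic_basis ::
  "('a::euclidean_space \<Rightarrow> 'a \<Rightarrow> real) \<Rightarrow> ('a \<Rightarrow> 'a \<Rightarrow> 'a) \<Rightarrow> 'a set \<Rightarrow> bool" where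
  "geodesic_basis ip br B \<longleftrightarrow> independent B \<and> span B = UNIV \<and>
     (\<forall>X\<in>B. geodesic_element ip br X)"

end

theory Submission
  imports Defs "HOL-Computational_Algebra.Fundamental_Theorem_Algebra"
begin

text \<open>
  For a solvable algebra with abelian nilradical \<open>N\<close> one has \<open>[g,g] \<subseteq> N\<close>, so the operators
  \<open>ad X\<close> commute on \<open>N\<close> and are traceless there. Decompose \<open>N\<close> into indecomposable summands
  \<open>N\<^sub>i\<close>: on each, \<open>ad X\<close> has generalised eigenvalues with one common real part \<open>\<lambda>\<^sub>i(X)\<close>,
  and an inner product on \<open>N\<^sub>i\<close> adapted to an invariant flag admits a spanning set of unit
  vectors \<open>e\<close> with \<open>\<langle>e, [X,e]\<rangle> = \<lambda>\<^sub>i(X)\<close>. Declaring the summands orthogonal, the vectors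
  \<open>\<Sum>\<^sub>i \<plusminus> sqrt (dim N\<^sub>i) e\<^sub>i\<close> are geodesic, because their quadratic form is the trace of \<open>ad X\<close>
  on \<open>N\<close>, and the choices of sign make them span \<open>N\<close>. Every vector orthogonal to \<open>N\<close> is geodesic
  since \<open>[g,g] \<subseteq> N\<close>.
\<close>

section \<open>Polynomials in an operator\<close>

text \<open>Over the reals, \<open>ad X\<close> on an indecomposable summand may have neither
  eigenvectors nor a diagonal form. The missing eigenvectors are replaced by a complex structure:
  once the common real part is subtracted, all operators act on an irreducible piece as multiples of
  one \<open>J\<close>, which is zero or satisfies \<open>J (J x) = - x\<close>, and a
  \<open>J\<close>-invariant inner product makes \<open>J x\<close> orthogonal to \<open>x\<close>.
  Failure of diagonalisability does no harm: the layers of the flag are made orthogonal and each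
  spanning vector stays in one layer, so the off-diagonal part of an operator does not enter its
  quadratic form. The weights come from the trace: on a combination of the unit vectors with
  coefficients c_i the form is the sum of c_i^2 lambda_i(X), and c_i^2 = dim N_i turns eigenvalue
  averages into a trace. The inclusion of [g,g] in \<open>N\<close> rests on Jacobson's lemma about
  nilpotent commutators, which avoids eigenvalues and hence any passage to the complex
  numbers.\<close>

definition poly_map :: "('a::euclidean_space \<Rightarrow> 'a) \<Rightarrow> real poly \<Rightarrow> 'a \<Rightarrow> 'a" where
  "poly_map A p x = (\<Sum>i\<le>degree p. coeff p i *\<^sub>R (A ^^ i) x)"

lemma linear_funpow:
  fixes A :: "'a::real_vector \<Rightarrow> 'a"
  assumes "linear A"
  shows "linear (A ^^ k)"
proof (induction k)
  case 0
  show ?case by (simp add: linear_id[unfolded id_def] id_def)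
next
  case (Suc k)
  then show ?case using assms by (simp add: linear_compose del: o_apply)
qed

lemma poly_map_0 [simp]: "poly_map A 0 x = 0"
  by (simp add: poly_map_def)

text \<open>Horner's rule; it spares the later inductions the degree bound of the defining
  sum.\<close>

lemma poly_map_pCons:
  assumes "linear A"
  shows "poly_map A (pCons c p) x = c *\<^sub>R x + A (poly_map A p x)"
proof (cases "p = 0")
  case True
  then show ?thesis using assms by (simp add: poly_map_def linear_0)
next
  case False
  then show ?thesis
    using assms
    by (simp add: poly_map_def sum.atMost_Suc_shift linear_sum linear_cmul
        del: sum.atMost_Suc)
qed

lemma poly_map_add:
  assumes "linear A"
  shows "poly_map A (p + q) x = poly_map A p x + poly_map A q x"
  by (induction p q rule: poly_induct2)
    (simp_all add: poly_map_pCons assms linear_add algebra_simps)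

lemma poly_map_smult:
  assumes "linear A"
  shows "poly_map A (smult c p) x = c *\<^sub>R poly_map A p x"
  by (induction p) (simp_all add: poly_map_pCons assms linear_cmul algebra_simps)

lemma poly_map_mult:
  assumes "linear A"
  shows "poly_map A (p * q) x = poly_map A p (poly_map A q x)"
  by (induction p) (simp_all add: poly_map_pCons poly_map_add poly_map_smult assms)

lemma linear_poly_map:
  assumes "linear A"
  shows "linear (poly_map A p)"
  unfolding poly_map_def[abs_def]
  by (intro linear_compose_sum ballI linear_compose_scale_right linear_funpow assms)

lemma poly_map_commute:
  assumes "linear A" "linear R" "\<And>x. A (R x) = R (A x)"
  shows "poly_map A p (R x) = R (poly_map A p x)"
  by (induction p)
    (simp_all add: poly_map_pCons assms linear_0 linear_add linear_cmul)

lemma poly_map_in_subspace: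
  assumes "linear A" "subspace W" "\<And>x. x \<in> W \<Longrightarrow> A x \<in> W" "x \<in> W"
  shows "poly_map A p x \<in> W"
  by (induction p)
    (simp_all add: poly_map_pCons assms subspace_0 subspace_add subspace_mul)

section \<open>Annihilating polynomials of an operator\<close>

lemma exists_annihilating_poly_at:
  fixes A :: "'a::euclidean_space \<Rightarrow> 'a"
  assumes A: "linear A"
  shows "\<exists>p. p \<noteq> 0 \<and> poly_map A p x = 0"
proof -
  define v where "v i = (A ^^ i) x" for i
  define poly_of where "poly_of c = (\<Sum>i\<le>DIM('a). monom (c i) i)" for c :: "nat \<Rightarrow> real"
  have monom: "poly_map A (monom c i) x = c *\<^sub>R v i" for c i
    by (induction i) (simp_all add: v_def monom_0 monom_Suc poly_map_pCons A linear_0 linear_cmul)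
  have pm: "poly_map A (poly_of c) x = (\<Sum>i\<le>DIM('a). c i *\<^sub>R v i)" for c
  proof -
    have "poly_map A (\<Sum>i\<in>F. monom (c i) i) x = (\<Sum>i\<in>F. c i *\<^sub>R v i)" if "finite F" for F
      using that by induction (simp_all add: poly_map_add A monom)
    then show ?thesis by (simp add: poly_of_def)
  qed
  have co: "coeff (poly_of c) i = c i" if "i \<le> DIM('a)" for c i
    using that by (simp add: poly_of_def coeff_sum)
  \<comment> \<open>The set of the vectors \<open>v i\<close> forgets repetitions: dimension
    counting applies when they are distinct, and a coincidence is itself a linear relation.\<close>
  have "\<exists>c. (\<exists>i\<le>DIM('a). c i \<noteq> 0) \<and> (\<Sum>i\<le>DIM('a). c i *\<^sub>R v i) = 0"
  proof (cases "inj_on v {..DIM('a)}")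
    case True
    then have "card (v ` {..DIM('a)}) > DIM('a)" by (simp add: card_image)
    then have "dependent (v ` {..DIM('a)})" by (simp add: dependent_biggerset)
    then obtain u where u: "\<exists>w\<in>v ` {..DIM('a)}. u w \<noteq> 0" "(\<Sum>w\<in>v ` {..DIM('a)}. u w *\<^sub>R w) = 0"
      by (auto simp: dependent_finite)
    have "(\<Sum>i\<le>DIM('a). u (v i) *\<^sub>R v i) = 0"
      using u(2) by (simp add: sum.reindex[OF True])
    with u(1) show ?thesis by (intro exI[of _ "u \<circ> v"]) auto
  next
    case False
    then obtain i j where ij: "i \<le> DIM('a)" "j \<le> DIM('a)" "i \<noteq> j" "v i = v j"
      by (auto simp: inj_on_def)
    let ?c = "\<lambda>k. (if k = i then 1 else 0) - (if k = j then 1 else (0::real))"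
    have "(\<Sum>k\<le>DIM('a). ?c k *\<^sub>R v k)
      = (\<Sum>k\<le>DIM('a). if k = i then v k else 0) - (\<Sum>k\<le>DIM('a). if k = j then v k else 0)"
      unfolding sum_subtractf[symmetric] by (rule sum.cong) auto
    also have "\<dots> = 0" using ij by simp
    finally show ?thesis using ij by (intro exI[of _ ?c]) auto
  qed
  then obtain c i where "i \<le> DIM('a)" "c i \<noteq> 0" "(\<Sum>i\<le>DIM('a). c i *\<^sub>R v i) = 0" by blast
  then show ?thesis
    using pm[of c] co[of i c] by (intro exI[of _ "poly_of c"]) auto
qed

text \<open>Polynomials in \<open>A\<close> commute, so the product of polynomials killing the
  individual basis vectors kills all of them.\<close>

lemma exists_annihilating_poly:
  fixes A :: "'a::euclidean_space \<Rightarrow> 'a"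
  assumes A: "linear A"
  shows "\<exists>p. p \<noteq> 0 \<and> (\<forall>x. poly_map A p x = 0)"
proof -
  have "\<exists>p. p \<noteq> 0 \<and> (\<forall>b\<in>F. poly_map A p b = 0)" if "finite F" for F
    using that
  proof induction
    case empty
    show ?case by (intro exI[of _ 1]) simp
  next
    case (insert b F)
    then obtain p where p: "p \<noteq> 0" "\<forall>b\<in>F. poly_map A p b = 0" by blast
    obtain q where q: "q \<noteq> 0" "poly_map A q b = 0"
      using exists_annihilating_poly_at[OF A] by blast
    have "poly_map A (q * p) y = 0" if "y \<in> insert b F" for y
    proof (cases "y = b")
      case True
      then show ?thesis
        using q by (simp add: mult.commute[of q] poly_map_mult A linear_0 linear_poly_map)
    next
      case False
      then show ?thesis
        using p that by (simp add: poly_map_mult A linear_0 linear_poly_map)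
    qed
    then show ?case using p(1) q(1) by (intro exI[of _ "q * p"]) simp
  qed
  from this[OF finite_Basis] obtain p
    where p: "p \<noteq> 0" "\<forall>b\<in>Basis. poly_map A p b = 0" by blast
  have "poly_map A p x = 0" for x
    using linear_eq_stdbasis[of "poly_map A p" "\<lambda>_. 0"] p(2) linear_poly_map[OF A]
    by (simp add: fun_eq_iff linear_zero)
  with p(1) show ?thesis by blast
qed

text \<open>Commuting with \<open>X\<close> acts as a derivation on polynomials in \<open>T\<close>;
  because \<open>R\<close> commutes with \<open>T\<close>, its copies can be gathered on one side,
  leaving the ordinary derivative.\<close>

lemma poly_map_commutator:
  assumes T: "linear T" and X: "linear X" and R: "\<And>v. R v = T (X v) - X (T v)"
    and TR: "\<And>v. T (R v) = R (T v)"
  shows "poly_map T p (X v) - X (poly_map T p v) = poly_map T (pderiv p) (R v)"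
proof (induction p arbitrary: v)
  case 0
  show ?case using X by (simp add: linear_0)
next
  case (pCons c p)
  have R_lin: "linear R"
    using linear_compose_sub[OF linear_compose[OF X T] linear_compose[OF T X]]
    by (simp add: R[abs_def] o_def)
  have "T (poly_map T p (X v)) - X (T (poly_map T p v))
      = R (poly_map T p v) + T (poly_map T p (X v) - X (poly_map T p v))"
    using T by (simp add: R linear_diff)
  also have "\<dots> = poly_map T p (R v) + T (poly_map T (pderiv p) (R v))"
    unfolding pCons.IH using poly_map_commute[OF T R_lin TR] by simp
  finally show ?case
    using T X by (simp add: poly_map_pCons pderiv_pCons poly_map_add linear_add linear_cmul)
qed

text \<open>Jacobson's lemma. If \<open>p\<close> annihilates \<open>T\<close>, commuting repeatedly with \<open>X\<close> turns
  \<open>p(T) = 0\<close> into \<open>p\<^sup>(\<^sup>k\<^sup>)(T) R\<^sup>m = 0\<close>, and the last nonzero derivative of \<open>p\<close> is a constant.\<close>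

lemma commutator_nilpotent:
  fixes T X :: "'a::euclidean_space \<Rightarrow> 'a"
  assumes T: "linear T" and X: "linear X" and R: "\<And>v. R v = T (X v) - X (T v)"
    and TR: "\<And>v. T (R v) = R (T v)"
  shows "\<exists>m. \<forall>v. (R ^^ m) v = 0"
proof -
  have R_lin: "linear R"
    using linear_compose_sub[OF linear_compose[OF X T] linear_compose[OF T X]]
    by (simp add: R[abs_def] o_def)
  have T_pow: "T ((R ^^ m) v) = (R ^^ m) (T v)" for m v
    by (induction m arbitrary: v) (simp_all add: TR)
  \<comment> \<open>The degree of \<open>p\<close> is lowered at the price of a larger power of
    \<open>R\<close>, so the claim is made for an arbitrary power \<open>m\<close>.\<close>
  have "\<exists>m. \<forall>v. (R ^^ m) v = 0" if "p \<noteq> 0" "\<forall>v. poly_map T p ((R ^^ m) v) = 0" for p m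
    using that
  proof (induction "degree p" arbitrary: p m)
    case 0
    then obtain c where "p = [:c:]" "c \<noteq> 0"
      by (metis degree_eq_zeroE pCons_eq_0_iff)
    with 0 show ?case using T by (auto simp: poly_map_pCons linear_0)
  next
    case (Suc n)
    have p: "poly_map T p ((R ^^ m) v) = 0" for v using Suc.prems by blast
    have comm: "poly_map T q ((R ^^ k) v) = (R ^^ k) (poly_map T q v)" for q k v
      using poly_map_commute[OF T linear_funpow[OF R_lin, of k] T_pow[of k]] by simp
    \<comment> \<open>In the exponent, the inner \<open>R^m\<close> kills the term
      \<open>X (p(T) w)\<close>, the single \<open>R\<close> is the commutator, and the outer
      \<open>R^m\<close> kills \<open>p(T) (X w)\<close>, since it can be moved past
      \<open>p(T)\<close> to stand before \<open>X\<close>.\<close>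
    have "poly_map T (pderiv p) ((R ^^ (m + Suc m)) v) = 0" for v
    proof -
      let ?w = "(R ^^ m) v"
      have "poly_map T (pderiv p) (R ?w) = poly_map T p (X ?w) - X (poly_map T p ?w)"
        using poly_map_commutator[OF T X R TR] by simp
      also have "\<dots> = poly_map T p (X ?w)" using p X by (simp add: linear_0)
      finally have "(R ^^ m) (poly_map T (pderiv p) (R ?w)) = poly_map T p ((R ^^ m) (X ?w))"
        using comm by simp
      then have "(R ^^ m) (poly_map T (pderiv p) (R ?w)) = 0" using p by simp
      then show ?thesis by (subst funpow_add) (simp add: comm)
    qed
    \<comment> \<open>Characteristic zero: differentiation lowers the degree of a nonconstant
      polynomial by exactly one.\<close>
    moreover have "pderiv p \<noteq> 0" "degree (pderiv p) = n"
      using Suc.hyps(2) by (auto simp: pderiv_eq_0_iff degree_pderiv)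
    ultimately show ?case using Suc.hyps(1)[of "pderiv p" "m + Suc m"] by blast
  qed
  from exists_annihilating_poly[OF T] this[of _ 0] show ?thesis by auto
qed

text \<open>A complex root a + bi of the least polynomial annihilating a nonzero \<open>x\<close>
  yields a real factor, t - a or (t - a)^2 + b^2, and by minimality the cofactor sends
  \<open>x\<close> to a nonzero vector killed by that factor. A real root is covered by the same
  quadratic with b = 0.\<close>

lemma exists_singular_quadratic:
  fixes A :: "'a::euclidean_space \<Rightarrow> 'a"
  assumes A: "linear A" and W: "subspace W" "W \<noteq> {0}" and inv: "\<And>x. x \<in> W \<Longrightarrow> A x \<in> W"
  shows "\<exists>a b. \<exists>x\<in>W. x \<noteq> 0 \<and> A (A x) - (2 * a) *\<^sub>R A x + (a\<^sup>2 + b\<^sup>2) *\<^sub>R x = 0"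
proof -
  obtain x where x: "x \<in> W" "x \<noteq> 0" using W subspace_0 by blast
  define Q where "Q p \<longleftrightarrow> p \<noteq> 0 \<and> poly_map A p x = 0" for p
  have "\<exists>p. Q p" using exists_annihilating_poly_at[OF A] by (auto simp: Q_def)
  then obtain p where p: "Q p" and least: "\<And>q. Q q \<Longrightarrow> degree p \<le> degree q"
    using ex_has_least_nat[of Q _ degree] by blast
  have "degree p \<noteq> 0"
  proof
    assume "degree p = 0"
    then obtain c where "p = [:c:]" by (metis degree_eq_zeroE)
    with p x show False using A by (auto simp: Q_def poly_map_pCons linear_0)
  qed
  then have "\<not> constant (poly (map_poly complex_of_real p))"
    by (simp add: constant_degree degree_map_poly)
  then obtain z where z: "poly (map_poly complex_of_real p) z = 0"
    using fundamental_theorem_of_algebra by blast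
  define a b where "a = Re z" and "b = Im z"
  have finish: ?thesis if "p = q * s" "degree q > 0"
    "\<And>y. poly_map A q y = 0 \<Longrightarrow> A (A y) - (2 * a) *\<^sub>R A y + (a\<^sup>2 + b\<^sup>2) *\<^sub>R y = 0" for q s
  proof -
    have nz: "q \<noteq> 0" "s \<noteq> 0" using that p by (auto simp: Q_def)
    have "degree s < degree p" using that nz by (simp add: degree_mult_eq)
    then have "poly_map A s x \<noteq> 0" using least[of s] nz by (auto simp: Q_def)
    moreover have "poly_map A q (poly_map A s x) = 0"
      using p that(1) by (simp add: Q_def poly_map_mult A)
    moreover have "poly_map A s x \<in> W" using A W inv x by (simp add: poly_map_in_subspace)
    ultimately show ?thesis using that(3) by blast
  qed
  show ?thesis
  proof (cases "b = 0")
    case True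
    then have "z = complex_of_real a" by (simp add: a_def b_def complex_eq_iff)
    moreover have "poly (map_poly complex_of_real q) (of_real x) = of_real (poly q x)" for q x
      by (induction q) (simp_all add: map_poly_pCons)
    ultimately have "poly p a = 0" using z by simp
    then obtain s where "p = [:- a, 1:] * s" by (auto simp: poly_eq_0_iff_dvd elim: dvdE)
    then show ?thesis
    proof (rule finish)
      fix y assume "poly_map A [:- a, 1:] y = 0"
      then have "A y = a *\<^sub>R y" using A by (simp add: poly_map_pCons linear_0)
      then show "A (A y) - (2 * a) *\<^sub>R A y + (a\<^sup>2 + b\<^sup>2) *\<^sub>R y = 0"
        using A True by (simp add: linear_cmul power2_eq_square scaleR_left_distrib[symmetric]
            scaleR_left_diff_distrib[symmetric])
    qed simp
  next
    case False
    \<comment> \<open>The real quadratic with roots \<open>z\<close> and its conjugate.\<close>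
    define q where "q = [:a\<^sup>2 + b\<^sup>2, - 2 * a, 1:]"
    have qz: "poly (map_poly complex_of_real q) z = 0"
      by (simp add: q_def a_def b_def complex_eq_iff power2_eq_square algebra_simps map_poly_pCons)
    define r where "r = p mod q"
    have dq: "degree q = 2" by (simp add: q_def)
    then have "q \<noteq> 0" by auto
    have p_eq: "p = q * (p div q) + r" by (simp add: r_def)
    have mult: "map_poly complex_of_real (f * g) = map_poly complex_of_real f * map_poly complex_of_real g"
      for f g by (intro poly_eqI) (simp add: coeff_map_poly coeff_mult)
    have add: "map_poly complex_of_real (f + g) = map_poly complex_of_real f + map_poly complex_of_real g"
      for f g by (intro poly_eqI) (simp add: coeff_map_poly)
    have "poly (map_poly complex_of_real (q * (p div q) + r)) z = 0" using z p_eq by simp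
    then have rz: "poly (map_poly complex_of_real r) z = 0"
      using qz by (simp add: mult add)
    have "degree r < 2" using degree_mod_less[OF \<open>q \<noteq> 0\<close>, of p] dq by (auto simp: r_def)
    then have "r = [:coeff r 0, coeff r 1:]"
      by (intro poly_eqI) (auto simp: coeff_pCons coeff_eq_0 split: nat.splits)
    then obtain c d where r: "r = [:c, d:]" by blast
    \<comment> \<open>A real polynomial of degree at most one that vanishes at a nonreal number is
      zero.\<close>
    have "r = 0" using rz False by (auto simp: r b_def complex_eq_iff map_poly_pCons)
    then have "p = q * (p div q)" using p_eq by simp
    then show ?thesis
    proof (rule finish)
      fix y assume "poly_map A q y = 0"
      then show "A (A y) - (2 * a) *\<^sub>R A y + (a\<^sup>2 + b\<^sup>2) *\<^sub>R y = 0"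
        using A by (simp add: q_def poly_map_pCons linear_0 linear_add linear_diff linear_cmul linear_neg algebra_simps)
    qed (simp add: dq)
  qed
qed

section \<open>Projections and traces on subspaces\<close>

lemma trace_map_commute:
  fixes f g :: "'a::euclidean_space \<Rightarrow> 'a"
  assumes "linear f" "linear g"
  shows "trace_map (\<lambda>x. f (g x)) = trace_map (\<lambda>x. g (f x))"
proof -
  have expand: "h (k b) \<bullet> b = (\<Sum>c\<in>Basis. (k b \<bullet> c) * (h c \<bullet> b))"
    if "linear h" for h k :: "'a \<Rightarrow> 'a" and b
  proof -
    have "h (k b) = h (\<Sum>c\<in>Basis. (k b \<bullet> c) *\<^sub>R c)" by (simp add: euclidean_representation)
    also have "\<dots> = (\<Sum>c\<in>Basis. (k b \<bullet> c) *\<^sub>R h c)" using that by (simp add: linear_sum linear_cmul)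
    finally show ?thesis by (simp add: inner_sum_left)
  qed
  have "trace_map (\<lambda>x. f (g x)) = (\<Sum>b\<in>Basis. \<Sum>c\<in>Basis. (g b \<bullet> c) * (f c \<bullet> b))"
    unfolding trace_map_def using expand[OF assms(1), of g] by simp
  also have "\<dots> = (\<Sum>c\<in>Basis. \<Sum>b\<in>Basis. (f c \<bullet> b) * (g b \<bullet> c))"
    by (subst sum.swap) (simp only: mult.commute)
  also have "\<dots> = trace_map (\<lambda>x. g (f x))"
    unfolding trace_map_def using expand[OF assms(2), of f] by simp
  finally show ?thesis .
qed

lemma trace_map_add: "trace_map (\<lambda>x. f x + g x) = trace_map f + trace_map g"
  by (simp add: trace_map_def inner_add_left sum.distrib)

lemma trace_map_scaleR: "trace_map (\<lambda>x. c *\<^sub>R f x) = c * trace_map f"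
  by (simp add: trace_map_def sum_distrib_left)

lemma trace_map_rank_one:
  assumes "linear \<alpha>"
  shows "trace_map (\<lambda>x. \<alpha> x *\<^sub>R w) = \<alpha> w"
proof -
  have "\<alpha> w = \<alpha> (\<Sum>b\<in>Basis. (w \<bullet> b) *\<^sub>R b)" by (simp add: euclidean_representation)
  also have "\<dots> = (\<Sum>b\<in>Basis. (w \<bullet> b) * \<alpha> b)" using assms by (simp add: linear_sum linear_cmul)
  finally show ?thesis by (simp add: trace_map_def mult.commute)
qed

text \<open>Orthogonality is not built in: the kernel of \<open>P\<close> is a freely chosen
  complement of \<open>W\<close>, which serves as a model of the quotient by
  \<open>W\<close>.\<close>

definition is_projection :: "('a::euclidean_space \<Rightarrow> 'a) \<Rightarrow> 'a set \<Rightarrow> bool" where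
  "is_projection P W \<longleftrightarrow> linear P \<and> (\<forall>x. P x \<in> W) \<and> (\<forall>x\<in>W. P x = x)"

lemma is_projectionD:
  assumes "is_projection P W"
  shows "linear P" "P x \<in> W" "x \<in> W \<Longrightarrow> P x = x"
  using assms by (auto simp: is_projection_def)

text \<open>The sum map on \<open>U \<times> C\<close> is injective, and \<open>P\<close> is the
  first component of a linear left inverse.\<close>

lemma exists_projection:
  fixes U C :: "'a::euclidean_space set"
  assumes "subspace U" "subspace C" "U \<inter> C = {0}"
  shows "\<exists>P. is_projection P U \<and> (\<forall>x\<in>C. P x = 0)"
proof -
  let ?f = "\<lambda>z::'a \<times> 'a. fst z + snd z"
  have lin: "linear ?f" by (auto intro!: linearI simp: algebra_simps)
  have sub: "subspace (U \<times> C)" using assms by (simp add: subspace_Times)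
  have "inj_on ?f (U \<times> C)"
  proof (subst linear_inj_on_iff_eq_0[OF lin])
    show "subspace (U \<times> C)" by (rule sub)
    show "\<forall>z\<in>U \<times> C. ?f z = 0 \<longrightarrow> z = 0"
    proof (intro ballI impI)
      fix z assume z: "z \<in> U \<times> C" "?f z = 0"
      then have "fst z = - snd z" by (simp add: eq_neg_iff_add_eq_0)
      then have "fst z \<in> U \<inter> C" using z assms(2) by (auto simp: subspace_neg)
      then have "fst z = 0" using assms by simp
      then show "z = 0" using z by (simp add: prod_eq_iff)
    qed
  qed
  then obtain g where g: "g ` UNIV \<subseteq> U \<times> C" "linear g" "\<forall>z\<in>U \<times> C. g (?f z) = z"
    using linear_exists_left_inverse_on[OF lin sub] by blast
  have "is_projection (fst \<circ> g) U"
    unfolding is_projection_def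
  proof (intro conjI ballI allI)
    show "linear (fst \<circ> g)" using g(2) linear_compose linear_fst by blast
    show "(fst \<circ> g) x \<in> U" for x using g(1) by (auto simp: image_subset_iff mem_Times_iff)
    show "(fst \<circ> g) x = x" if "x \<in> U" for x
      using g(3)[rule_format, of "(x, 0)"] that assms(2) by (simp add: subspace_0)
  qed
  moreover have "(fst \<circ> g) x = 0" if "x \<in> C" for x
    using g(3)[rule_format, of "(0, x)"] that assms(1) by (simp add: subspace_0)
  ultimately show ?thesis by blast
qed

lemma exists_projection_onto:
  fixes U :: "'a::euclidean_space set"
  assumes "subspace U"
  shows "\<exists>P. is_projection P U"
  using exists_projection[OF assms subspace_single_0] assms subspace_0 by auto

section \<open>Traces on invariant subspaces\<close>

definition trace_on :: "'a::euclidean_space set \<Rightarrow> ('a \<Rightarrow> 'a) \<Rightarrow> real" where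
  "trace_on W A = trace_map (\<lambda>x. A ((SOME P. is_projection P W) x))"

text \<open>With \<open>R\<close> the chosen projection, \<open>A R\<close> equals
  \<open>A P R\<close>; cyclicity of the trace turns this into \<open>R A P\<close>, and
  \<open>R\<close> fixes the values of \<open>A P\<close> because \<open>W\<close> is invariant. So
  the choice made by \<open>SOME\<close> is immaterial.\<close>

lemma trace_on_eq:
  assumes P: "is_projection P W" and A: "linear A" "\<And>x. x \<in> W \<Longrightarrow> A x \<in> W"
  shows "trace_on W A = trace_map (\<lambda>x. A (P x))"
proof -
  define R where "R = (SOME P. is_projection P W)"
  have R: "is_projection R W" unfolding R_def by (rule someI[of "\<lambda>P. is_projection P W", OF P])
  have "trace_map (\<lambda>x. A (R x)) = trace_map (\<lambda>x. (\<lambda>x. A (P x)) (R x))"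
    using P R by (simp add: is_projection_def)
  also have "\<dots> = trace_map (\<lambda>x. R (A (P x)))"
    using linear_compose[OF is_projectionD(1)[OF P] A(1)] R
    by (intro trace_map_commute) (auto simp: is_projection_def o_def)
  also have "\<dots> = trace_map (\<lambda>x. A (P x))"
    using P R A(2) by (simp add: is_projection_def)
  finally show ?thesis by (simp add: trace_on_def R_def)
qed

lemma is_projection_some:
  assumes "subspace W"
  shows "is_projection (SOME P. is_projection P W) W"
  using exists_projection_onto[OF assms] by (rule someI_ex)

lemma trace_on_cong:
  assumes "subspace W" "\<And>x. x \<in> W \<Longrightarrow> A x = B x"
  shows "trace_on W A = trace_on W B"
  using is_projectionD(2)[OF is_projection_some[OF assms(1)]] assms(2)
  by (simp add: trace_on_def)

lemma trace_on_add: "trace_on W (\<lambda>x. A x + B x) = trace_on W A + trace_on W B"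
  by (simp add: trace_on_def trace_map_add)

lemma trace_on_scaleR: "trace_on W (\<lambda>x. c *\<^sub>R A x) = c * trace_on W A"
  by (simp add: trace_on_def trace_map_scaleR)

lemma trace_on_trivial:
  assumes "linear A"
  shows "trace_on {0} A = 0"
proof -
  have "(SOME P. is_projection P {0}) x = 0" for x :: 'a
    using is_projectionD(2)[OF is_projection_some[OF subspace_single_0]] by simp
  then show ?thesis using assms by (simp add: trace_on_def trace_map_def linear_0)
qed

text \<open>The operator is block triangular for \<open>U\<close> inside \<open>W\<close>. The
  complement \<open>{x \<in> W. P x = 0}\<close> stands for the quotient \<open>W / U\<close>, and
  \<open>A x - P (A x)\<close> is the operator induced on it.\<close>

lemma trace_on_split:
  assumes W: "subspace W" and U: "U \<subseteq> W" and P: "is_projection P U"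
    and A: "linear A" "\<And>x. x \<in> W \<Longrightarrow> A x \<in> W" "\<And>x. x \<in> U \<Longrightarrow> A x \<in> U"
  shows "trace_on W A = trace_on U A + trace_on {x \<in> W. P x = 0} (\<lambda>x. A x - P (A x))"
proof -
  obtain R where R: "is_projection R W" using exists_projection_onto[OF W] by blast
  note lin = is_projectionD(1)[OF R] is_projectionD(1)[OF P] A(1)
  let ?C = "{x \<in> W. P x = 0}"
  define Q where "Q x = R x - P (R x)" for x
  have Qlin: "linear Q"
    using linear_compose_sub[OF lin(1) linear_compose[OF lin(1,2)]]
    by (simp add: Q_def[abs_def] o_def)
  have Q: "is_projection Q ?C"
    unfolding is_projection_def
  proof (intro conjI Qlin allI ballI)
    show "Q x \<in> ?C" for x
      using P R U lin by (auto simp: Q_def is_projection_def linear_diff intro!: subspace_diff[OF W])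
    show "Q x = x" if "x \<in> ?C" for x
      using that R by (simp add: Q_def is_projection_def)
  qed
  have PR: "is_projection (\<lambda>x. P (R x)) U"
    using linear_compose[OF lin(1,2)] P R U by (auto simp: is_projection_def o_def)
  have "trace_on W A = trace_map (\<lambda>x. A (P (R x)) + A (Q x))"
    using trace_on_eq[OF R A(1,2)] lin by (simp add: Q_def linear_diff)
  also have "\<dots> = trace_on U A + trace_map (\<lambda>x. A (Q x))"
    using trace_on_eq[OF PR A(1,3)] by (simp add: trace_map_add)
  also have "trace_map (\<lambda>x. A (Q x)) = trace_map (\<lambda>x. (\<lambda>x. A (Q x)) (Q x))"
    using Q by (simp add: is_projection_def)
  also have "\<dots> = trace_map (\<lambda>x. Q (A (Q x)))"
    using linear_compose[OF Qlin A(1)] Qlin by (intro trace_map_commute) (simp_all add: o_def)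
  also have "\<dots> = trace_map (\<lambda>x. A (Q x) - P (A (Q x)))"
    using Q R A(2) by (simp add: is_projection_def Q_def)
  also have "\<dots> = trace_on ?C (\<lambda>x. A x - P (A x))"
  proof (rule trace_on_eq[OF Q, symmetric])
    show "linear (\<lambda>x. A x - P (A x))"
      using linear_compose_sub[OF A(1) linear_compose[OF A(1) lin(2)]] by (simp add: o_def)
    show "A x - P (A x) \<in> ?C" if "x \<in> ?C" for x
      using that P U A(2) lin by (auto simp: is_projection_def linear_diff intro!: subspace_diff[OF W])
  qed
  finally show ?thesis .
qed

text \<open>This trace is the dimension: by \<open>trace_on_eq\<close> the orthogonal projection may
  be used, and its trace counts an orthonormal basis. Positivity later allows division by
  it.\<close>

lemma trace_on_id_pos:
  fixes W :: "'a::euclidean_space set"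
  assumes W: "subspace W" "W \<noteq> {0}"
  shows "trace_on W (\<lambda>x. x) > 0"
proof -
  obtain E where E: "E \<subseteq> W" "pairwise orthogonal E" "\<And>x. x \<in> E \<Longrightarrow> norm x = 1"
    "independent E" "card E = dim W" "span E = W"
    using orthonormal_basis_subspace[OF W(1)] by metis
  have fin: "finite E" using E(4) by (rule independent_imp_finite)
  define P where "P x = (\<Sum>e\<in>E. (x \<bullet> e) *\<^sub>R e)" for x
  have P: "is_projection P W"
    unfolding is_projection_def
  proof (intro conjI allI ballI)
    show "linear P"
      by (auto intro!: linearI simp: P_def inner_add_left scaleR_add_left sum.distrib scaleR_sum_right)
    show "P x \<in> W" for x
      unfolding P_def E(6)[symmetric] by (intro span_sum span_scale span_base)
    show "P x = x" if "x \<in> W" for x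
    proof -
      have "P x = id x"
      proof (rule linear_eq_on_span[OF \<open>linear P\<close> linear_id])
        show "x \<in> span E" using that E by simp
        fix f assume f: "f \<in> E"
        have "P f = (\<Sum>e\<in>E. if e = f then f else 0)"
          unfolding P_def
        proof (rule sum.cong)
          fix e assume e: "e \<in> E"
          show "(f \<bullet> e) *\<^sub>R e = (if e = f then f else 0)"
            using E(2,3) e f by (auto simp: pairwise_def orthogonal_def norm_eq_1)
        qed simp
        then show "P f = id f" using f fin by simp
      qed
      then show ?thesis by simp
    qed
  qed
  have "trace_on W (\<lambda>x. x) = trace_map P" using trace_on_eq[OF P] linear_id by (simp add: id_def)
  also have "\<dots> = (\<Sum>b\<in>Basis. \<Sum>e\<in>E. (b \<bullet> e)\<^sup>2)"
    unfolding trace_map_def P_def inner_sum_left inner_scaleR_left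
    by (simp add: power2_eq_square inner_commute)
  also have "\<dots> = (\<Sum>e\<in>E. \<Sum>b\<in>Basis. (b \<bullet> e)\<^sup>2)" by (rule sum.swap)
  also have "\<dots> = (\<Sum>e\<in>E. 1)"
  proof (rule sum.cong)
    fix e assume "e \<in> E"
    then have "e \<bullet> e = 1" using E(3) by (simp add: norm_eq_1)
    then show "(\<Sum>b\<in>Basis. (b \<bullet> e)\<^sup>2) = 1"
      by (subst (asm) euclidean_inner) (simp add: power2_eq_square inner_commute)
  qed simp
  finally have "trace_on W (\<lambda>x. x) = dim W" using E(5) by simp
  moreover have "dim W \<noteq> 0" using W by (auto simp: subspace_0)
  ultimately show ?thesis by (simp only: of_nat_0_less_iff neq0_conv)
qed

section \<open>Commuting families of operators\<close>

text \<open>Invariance and commutation are asked on \<open>W\<close> alone, so that the maps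
  \<open>br x\<close> qualify on the nilradical although they need not commute on the whole
  algebra.\<close>

definition commuting_family :: "'a::euclidean_space set \<Rightarrow> ('i \<Rightarrow> 'a \<Rightarrow> 'a) \<Rightarrow> bool" where
  "commuting_family W A \<longleftrightarrow> subspace W \<and> (\<forall>i. linear (A i)) \<and> (\<forall>i. \<forall>x\<in>W. A i x \<in> W) \<and>
     (\<forall>i j. \<forall>x\<in>W. A i (A j x) = A j (A i x))"

lemma commuting_familyD:
  assumes "commuting_family W A"
  shows "subspace W" "linear (A i)" "x \<in> W \<Longrightarrow> A i x \<in> W"
    "x \<in> W \<Longrightarrow> A i (A j x) = A j (A i x)"
  using assms unfolding commuting_family_def by blast+

lemma commuting_family_subset:
  assumes "commuting_family W A" "subspace U" "U \<subseteq> W" "\<And>i x. x \<in> U \<Longrightarrow> A i x \<in> U"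
  shows "commuting_family U A"
  using assms unfolding commuting_family_def by blast

text \<open>Bilinear and symmetric everywhere but positive on \<open>W\<close> alone: such forms can
  be composed with projections and added without restricting domains.\<close>

definition inner_on :: "'a::euclidean_space set \<Rightarrow> ('a \<Rightarrow> 'a \<Rightarrow> real) \<Rightarrow> bool" where
  "inner_on W ip \<longleftrightarrow> bilinear ip \<and> (\<forall>x y. ip x y = ip y x) \<and> (\<forall>x\<in>W. x \<noteq> 0 \<longrightarrow> ip x x > 0)"

lemma inner_onD:
  assumes "inner_on W ip"
  shows "bilinear ip" "ip x y = ip y x" "x \<in> W \<Longrightarrow> x \<noteq> 0 \<Longrightarrow> ip x x > 0"
  using assms unfolding inner_on_def by blast+

lemma inner_on_nonneg:
  assumes "inner_on W ip" "x \<in> W"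
  shows "ip x x \<ge> 0"
  using inner_onD(3)[OF assms] bilinear_lzero[OF inner_onD(1)[OF assms(1)]]
  by (cases "x = 0") (auto simp: less_imp_le)

text \<open>Independence is left out, since families with all choices of sign are far from
  independent. Unit length makes the quadratic form of a scalar operator equal to the
  scalar.\<close>

definition unit_spanning :: "('a::euclidean_space \<Rightarrow> 'a \<Rightarrow> real) \<Rightarrow> 'a set \<Rightarrow> 'a set \<Rightarrow> bool" where
  "unit_spanning ip W B \<longleftrightarrow> span B = W \<and> (\<forall>e\<in>B. ip e e = 1)"

lemma unit_spanningD:
  assumes "unit_spanning ip W B"
  shows "B \<subseteq> W" "span B = W" "e \<in> B \<Longrightarrow> ip e e = 1"
  using assms span_superset unfolding unit_spanning_def by auto

text \<open>The orthogonal sum of \<open>f\<close> and \<open>g\<close>: \<open>U\<close> and its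
  complement in \<open>W\<close> become perpendicular.\<close>

lemma inner_on_glue:
  assumes W: "subspace W" "U \<subseteq> W" and P: "is_projection P U"
    and f: "inner_on U f" and g: "inner_on {x \<in> W. P x = 0} g"
  shows "inner_on W (\<lambda>x y. f (P x) (P y) + g (x - P x) (y - P y))"
  unfolding inner_on_def
proof (intro conjI allI ballI impI)
  note Pl = is_projectionD(1)[OF P]
  note fb = inner_onD(1)[OF f] and gb = inner_onD(1)[OF g]
  note simps = linear_add[OF Pl] linear_cmul[OF Pl] bilinear_ladd[OF fb] bilinear_radd[OF fb]
    bilinear_lmul[OF fb] bilinear_rmul[OF fb] bilinear_ladd[OF gb] bilinear_radd[OF gb]
    bilinear_lmul[OF gb] bilinear_rmul[OF gb] bilinear_lsub[OF gb] bilinear_rsub[OF gb]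
  show "bilinear (\<lambda>x y. f (P x) (P y) + g (x - P x) (y - P y))"
    unfolding bilinear_def linear_iff by (simp add: simps algebra_simps)
  show "f (P x) (P y) + g (x - P x) (y - P y) = f (P y) (P x) + g (y - P y) (x - P x)" for x y
    using inner_onD(2)[OF f, of "P x"] inner_onD(2)[OF g, of "x - P x"] by simp
  fix x assume x: "x \<in> W" "x \<noteq> 0"
  have 1: "P x \<in> U" using P by (simp add: is_projection_def)
  moreover have "x - P x \<in> W" using 1 W x by (blast intro: subspace_diff)
  ultimately have 2: "x - P x \<in> {x \<in> W. P x = 0}"
    using P Pl by (simp add: linear_diff is_projection_def)
  show "f (P x) (P x) + g (x - P x) (x - P x) > 0"
  proof (cases "P x = 0")
    case True
    then show ?thesis
      using inner_onD(3)[OF g 2] x bilinear_lzero[OF fb] by simp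
  next
    case False
    then show ?thesis
      using inner_onD(3)[OF f 1] inner_on_nonneg[OF g 2] by simp
  qed
qed

text \<open>Once the kernels and images of the powers of \<open>T\<close> on \<open>W\<close> stop
  changing, they are complementary.\<close>

lemma fitting_decomposition:
  fixes T :: "'a::euclidean_space \<Rightarrow> 'a"
  assumes T: "linear T" and W: "subspace W" and inv: "\<And>x. x \<in> W \<Longrightarrow> T x \<in> W"
  obtains k where "k > 0" "{x \<in> W. (T ^^ k) x = 0} \<inter> (T ^^ k) ` W = {0}"
    "\<And>w. w \<in> W \<Longrightarrow> \<exists>u\<in>W. (T ^^ k) (w - (T ^^ k) u) = 0"
proof -
  note lin = linear_funpow[OF T]
  have inv_pow: "(T ^^ k) x \<in> W" if "x \<in> W" for k x
    using that inv by (induction k) auto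
  define K where "K k = {x \<in> W. (T ^^ k) x = 0}" for k
  define I where "I k = (T ^^ k) ` W" for k
  have subK: "subspace (K k)" for k
    using W lin[of k]
    by (auto simp: K_def subspace_def linear_0 linear_add linear_cmul)
  have subI: "subspace (I k)" for k
    unfolding I_def using linear_subspace_image[OF lin W] .
  \<comment> \<open>Image dimension plus kernel codimension, both nonincreasing in \<open>k\<close>:
    at a minimum, passing from \<open>k\<close> to \<open>k + k\<close> changes neither. The
    subtraction does not truncate.\<close>
  define f where "f k = dim (I k) + (DIM('a) - dim (K k))" for k
  \<comment> \<open>A positive \<open>k\<close> ensures that a vector killed by \<open>T\<close> is
    also killed by \<open>T ^^ k\<close>.\<close>
  obtain k where "k > 0" and least: "\<And>j. j > 0 \<Longrightarrow> f k \<le> f j"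
    using ex_has_least_nat[of "\<lambda>k. k > 0" 1 f] by auto
  have K: "K k \<subseteq> K (k + k)" using lin[of k] by (auto simp: K_def funpow_add linear_0)
  have I: "I (k + k) \<subseteq> I k" using inv_pow by (auto simp: I_def funpow_add)
  have "f k \<le> f (k + k)" using \<open>k > 0\<close> by (intro least) simp
  moreover have "dim (K k) \<le> dim (K (k + k))" "dim (I (k + k)) \<le> dim (I k)"
    using K I by (auto intro: dim_subset)
  moreover have "dim (K (k + k)) \<le> DIM('a)" by (rule dim_subset_UNIV)
  ultimately have "dim (K (k + k)) \<le> dim (K k)" "dim (I k) \<le> dim (I (k + k))"
    unfolding f_def by linarith+
  then have Keq: "K k = K (k + k)" and Ieq: "I (k + k) = I k"
    using subspace_dim_equal[OF subK subK K] subspace_dim_equal[OF subI subI I] by auto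
  show ?thesis
  proof
    show "k > 0" by fact
    show "{x \<in> W. (T ^^ k) x = 0} \<inter> (T ^^ k) ` W = {0}"
    proof
      show "{x \<in> W. (T ^^ k) x = 0} \<inter> (T ^^ k) ` W \<subseteq> {0}"
      proof
        fix x assume "x \<in> {x \<in> W. (T ^^ k) x = 0} \<inter> (T ^^ k) ` W"
        then obtain u where u: "u \<in> W" "x = (T ^^ k) u" "(T ^^ k) x = 0" by auto
        then have "u \<in> K (k + k)" by (simp add: K_def funpow_add)
        then have "u \<in> K k" using Keq by simp
        then show "x \<in> {0}" using u by (simp add: K_def)
      qed
      show "{0} \<subseteq> {x \<in> W. (T ^^ k) x = 0} \<inter> (T ^^ k) ` W"
        using subspace_0[OF subI[of k]] subspace_0[OF subK[of k]] by (simp add: I_def K_def)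
    qed
    fix w assume w: "w \<in> W"
    then have "(T ^^ k) w \<in> I (k + k)" using Ieq by (simp add: I_def)
    then obtain u where "u \<in> W" "(T ^^ k) w = (T ^^ k) ((T ^^ k) u)"
      by (auto simp: I_def funpow_add)
    then show "\<exists>u\<in>W. (T ^^ k) (w - (T ^^ k) u) = 0"
      using linear_diff[OF lin] by auto
  qed
qed

section \<open>Families with purely imaginary eigenvalues\<close>

lemma nilpotent_kernel:
  assumes "(T ^^ k) u = 0" "u \<noteq> (0::'a::zero)"
  shows "\<exists>j. (T ^^ j) u \<noteq> 0 \<and> T ((T ^^ j) u) = 0"
  using assms
proof (induction k)
  case (Suc k)
  then show ?case by (cases "(T ^^ k) u = 0") auto
qed simp

text \<open>In the basis \<open>u\<close>, \<open>J u\<close> the matrix of \<open>J\<close> has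
  zero diagonal.\<close>

lemma span_pair_trace_zero:
  fixes J :: "'a::euclidean_space \<Rightarrow> 'a"
  assumes J: "linear J" and u: "u \<noteq> 0" "J (J u) = - u" and U: "U = span {u, J u}"
  shows "trace_on U J = 0"
proof -
  let ?f = "\<lambda>z::real \<times> real. fst z *\<^sub>R u + snd z *\<^sub>R J u"
  have lin: "linear ?f" by (auto intro!: linearI simp: algebra_simps)
  have "inj ?f"
  proof (subst linear_injective_0[OF lin], intro allI impI)
    fix z assume z: "?f z = 0"
    \<comment> \<open>Applying \<open>J\<close> to the relation and eliminating \<open>J u\<close>
      leaves \<open>u\<close> multiplied by a sum of two squares.\<close>
    have "J (?f z) = fst z *\<^sub>R J u - snd z *\<^sub>R u"
      using J u by (simp add: linear_add linear_cmul)
    then have "fst z *\<^sub>R J u - snd z *\<^sub>R u = 0" using z J by (simp add: linear_0)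
    then have "fst z *\<^sub>R ?f z - snd z *\<^sub>R (fst z *\<^sub>R J u - snd z *\<^sub>R u) = 0" using z by simp
    then have "((fst z)\<^sup>2 + (snd z)\<^sup>2) *\<^sub>R u = 0"
      by (simp add: algebra_simps power2_eq_square)
    then show "z = 0" using u by (simp add: prod_eq_iff sum_power2_eq_zero_iff)
  qed
  then obtain g where g: "linear g" "g \<circ> ?f = id"
    using linear_injective_left_inverse[OF lin] by blast
  have gf: "g (s *\<^sub>R u + t *\<^sub>R J u) = (s, t)" for s t
    using fun_cong[OF g(2), of "(s, t)"] by simp
  have l1: "linear (\<lambda>x. fst (g x))" "linear (\<lambda>x. snd (g x))"
    using linear_compose[OF g(1) linear_fst] linear_compose[OF g(1) linear_snd] by (simp_all add: o_def)
  define P where "P x = fst (g x) *\<^sub>R u + snd (g x) *\<^sub>R J u" for x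
  have Ueq: "U = {s *\<^sub>R u + t *\<^sub>R J u |s t. True}"
    unfolding U span_insert span_empty by (auto simp: algebra_simps)
  have P: "is_projection P U"
    unfolding is_projection_def
  proof (intro conjI allI ballI)
    show "linear P"
      unfolding linear_iff P_def
      by (simp add: linear_add[OF g(1)] linear_cmul[OF g(1)] algebra_simps)
    show "P x \<in> U" for x by (auto simp: P_def Ueq)
    show "P x = x" if "x \<in> U" for x using that gf by (auto simp: P_def Ueq)
  qed
  have inv: "J x \<in> U" if x: "x \<in> U" for x
  proof -
    obtain s t where "x = s *\<^sub>R u + t *\<^sub>R J u" using x Ueq by auto
    then have "J x = (- t) *\<^sub>R u + s *\<^sub>R J u" using J u by (simp add: linear_add linear_cmul)
    then show ?thesis unfolding Ueq by blast
  qed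
  have "trace_on U J = trace_map (\<lambda>x. fst (g x) *\<^sub>R J u + snd (g x) *\<^sub>R (- u))"
    using trace_on_eq[OF P J inv] J u by (simp add: P_def linear_add linear_cmul)
  also have "\<dots> = fst (g (J u)) + snd (g (- u))"
    by (simp only: trace_map_add trace_map_rank_one l1)
  also have "\<dots> = 0" using gf[of 0 1] gf[of "- 1" 0] by simp
  finally show ?thesis .
qed

text \<open>A real form of Schur's lemma: each \<open>A i\<close> squares to the scalar -(b i)^2, so
  all are multiples of one operator \<open>J\<close>, which is zero or a complex structure.
  Averaging the inner product over \<open>J\<close> makes \<open>J x\<close> perpendicular to
  \<open>x\<close>.\<close>

lemma irreducible_imaginary_family:
  fixes A :: "'i \<Rightarrow> 'a::euclidean_space \<Rightarrow> 'a"
  assumes A: "commuting_family U A" and U: "U \<noteq> {0}"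
    and irred: "\<And>V. subspace V \<Longrightarrow> V \<subseteq> U \<Longrightarrow> V \<noteq> {0} \<Longrightarrow> (\<And>i x. x \<in> V \<Longrightarrow> A i x \<in> V) \<Longrightarrow> V = U"
    and nil: "\<And>i. \<exists>k. \<forall>x\<in>U. ((\<lambda>x. A i (A i x) + (b i)\<^sup>2 *\<^sub>R x) ^^ k) x = 0"
  shows "\<exists>ip B. inner_on U ip \<and> unit_spanning ip U B \<and>
    (\<forall>i. \<forall>e\<in>B. ip e (A i e) = 0) \<and> (\<forall>i. trace_on U (A i) = 0)"
proof -
  note D = commuting_familyD[OF A]
  obtain u where u: "u \<in> U" "u \<noteq> 0" using D(1) U subspace_0 by blast
  \<comment> \<open>The kernel of an operator commuting with the family is invariant, so it is all
    of \<open>U\<close> as soon as it is nonzero.\<close>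
  have schur: "S x = 0"
    if S: "linear S" "\<And>i x. x \<in> U \<Longrightarrow> S (A i x) = A i (S x)" and y: "y \<in> U" "y \<noteq> 0" "S y = 0"
      and x: "x \<in> U" for S x y
  proof -
    have "{x \<in> U. S x = 0} = U"
    proof (rule irred)
      show "subspace {x \<in> U. S x = 0}"
        using D(1) S(1) by (auto simp: subspace_def linear_0 linear_add linear_cmul)
      show "A i x \<in> {x \<in> U. S x = 0}" if "x \<in> {x \<in> U. S x = 0}" for i x
        using that S D linear_0[OF D(2)] by auto
    qed (use y in auto)
    then show ?thesis using x by blast
  qed
  have square: "A i (A i x) = - ((b i)\<^sup>2 *\<^sub>R x)" if "x \<in> U" for i x
  proof -
    define T where "T x = A i (A i x) + (b i)\<^sup>2 *\<^sub>R x" for x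
    have T: "linear T"
      unfolding T_def linear_iff
      by (simp add: linear_add[OF D(2)] linear_cmul[OF D(2)] algebra_simps)
    have "T x \<in> U" if "x \<in> U" for x
      using that D by (simp add: T_def subspace_add subspace_mul)
    then have TU: "(T ^^ j) x \<in> U" if "x \<in> U" for j x
      using that by (induction j) auto
    \<comment> \<open>Nilpotency supplies a kernel vector, and \<open>schur\<close> then improves
      nilpotent to zero.\<close>
    obtain k where "(T ^^ k) u = 0" using nil[of i] u unfolding T_def by blast
    then obtain j where j: "(T ^^ j) u \<noteq> 0" "T ((T ^^ j) u) = 0"
      using nilpotent_kernel u by blast
    have "T x = 0"
    proof (rule schur[OF T _ TU[OF u(1)] j \<open>x \<in> U\<close>])
      show "T (A m x) = A m (T x)" if "x \<in> U" for m x
        using that D by (simp add: T_def linear_add[OF D(2)] linear_cmul[OF D(2)])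
    qed
    then show ?thesis by (simp add: T_def eq_neg_iff_add_eq_0)
  qed
  obtain J where J: "linear J" and JA: "\<And>i. \<exists>c. \<forall>x\<in>U. A i x = c *\<^sub>R J x"
    and J2: "(\<forall>x\<in>U. J x = 0) \<or> (\<forall>x\<in>U. J (J x) = - x)" and JU: "\<And>x. x \<in> U \<Longrightarrow> J x \<in> U"
  proof (cases "\<forall>i. b i = 0")
    case True
    have zero: "A i x = 0" if "x \<in> U" for i x
    proof -
      \<comment> \<open>Here \<open>A i\<close> has square zero, so \<open>u\<close> or
        \<open>A i u\<close> is a nonzero vector in its kernel.\<close>
      obtain y where y: "y \<in> U" "y \<noteq> 0" "A i y = 0"
      proof (cases "A i u = 0")
        case False
        have "A i (A i u) = 0" using square[OF u(1)] True by simp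
        with False u D(3) that show thesis by blast
      qed (use u that in blast)
      show ?thesis using schur[OF D(2)[of i] _ y \<open>x \<in> U\<close>] D(4) by blast
    qed
    show thesis
      by (rule that[of "\<lambda>_. 0"]) (use zero D(1) in \<open>auto simp: linear_zero subspace_0\<close>)
  next
    case False
    then obtain m where m: "b m \<noteq> 0" by blast
    define J where "J x = (1 / b m) *\<^sub>R A m x" for x
    have J: "linear J" unfolding J_def using D(2) by (rule linear_compose_scale_right)
    have JU: "J x \<in> U" if "x \<in> U" for x using that D by (simp add: J_def subspace_mul)
    have JJ: "J (J x) = - x" if "x \<in> U" for x
      using that m by (simp add: J_def linear_cmul[OF D(2)] square power2_eq_square)
    have JA: "J (A i x) = A i (J x)" if "x \<in> U" for i x
      using that D(4) by (simp add: J_def linear_cmul[OF D(2)])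
    have "\<exists>c. \<forall>x\<in>U. A i x = c *\<^sub>R J x" for i
    proof -
      have lin: "linear (\<lambda>x. A i x + c *\<^sub>R J x)" for c
        unfolding linear_iff
        by (simp add: linear_add[OF D(2)] linear_cmul[OF D(2)] linear_add[OF J] linear_cmul[OF J] algebra_simps)
      have comm: "A i (A j x) + c *\<^sub>R J (A j x) = A j (A i x + c *\<^sub>R J x)" if "x \<in> U" for c j x
        using that D(4)[of x i j] by (simp add: linear_add[OF D(2)] linear_cmul[OF D(2)] JA)
      \<comment> \<open>On \<open>U\<close> the product of \<open>A i + b i J\<close> and
        \<open>A i - b i J\<close> vanishes. Hence one factor kills a nonzero vector, and by
        \<open>schur\<close> that factor is zero.\<close>
      show ?thesis
      proof (cases "A i u + b i *\<^sub>R J u = 0")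
        case True
        have "A i x + b i *\<^sub>R J x = 0" if "x \<in> U" for x
          using schur[OF lin comm u True that] by blast
        then have "\<forall>x\<in>U. A i x = (- b i) *\<^sub>R J x" by (simp add: eq_neg_iff_add_eq_0)
        then show ?thesis by blast
      next
        case False
        let ?v = "A i u + b i *\<^sub>R J u"
        have v: "?v \<in> U" using u D JU by (simp add: subspace_add subspace_mul)
        have "A i ?v + (- b i) *\<^sub>R J ?v = 0"
          using u(1) by (simp add: linear_add[OF D(2)] linear_cmul[OF D(2)] linear_add[OF J]
              linear_cmul[OF J] square JJ JA power2_eq_square algebra_simps)
        then have "A i x + (- b i) *\<^sub>R J x = 0" if "x \<in> U" for x
          using schur[OF lin comm v False _ that] by blast
        then have "\<forall>x\<in>U. A i x = b i *\<^sub>R J x" by simp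
        then show ?thesis by blast
      qed
    qed
    then show thesis using J JU JJ that by blast
  qed
  have trace_J: "trace_on U J = 0"
    using J2
  proof
    assume "\<forall>x\<in>U. J x = 0"
    then have "trace_on U J = trace_on U (\<lambda>x. 0 *\<^sub>R J x)" using D(1) by (intro trace_on_cong) auto
    also have "\<dots> = 0 * trace_on U J" by (rule trace_on_scaleR)
    finally show ?thesis by simp
  next
    assume JJ: "\<forall>x\<in>U. J (J x) = - x"
    \<comment> \<open>Every \<open>A i\<close> is a multiple of \<open>J\<close>, so this plane is
      invariant and irreducibility makes it all of \<open>U\<close>.\<close>
    have "span {u, J u} = U"
    proof (rule irred)
      show "span {u, J u} \<subseteq> U" using u JU D(1) by (intro span_minimal) auto
      show "span {u, J u} \<noteq> {0}" using u span_base[of u "{u, J u}"] by auto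
      show "A i x \<in> span {u, J u}" if "x \<in> span {u, J u}" for i x
      proof -
        obtain c where c: "\<forall>x\<in>U. A i x = c *\<^sub>R J x" using JA by blast
        have "A i ` span {u, J u} = span (A i ` {u, J u})"
          using linear_span_image[OF D(2)] by metis
        also have "\<dots> \<subseteq> span {u, J u}"
        proof (rule span_minimal)
          have "A i u = c *\<^sub>R J u" "A i (J u) = (- c) *\<^sub>R u" using c u JU JJ by auto
          then show "A i ` {u, J u} \<subseteq> span {u, J u}"
            using span_scale[OF span_base[of u "{u, J u}"], of "- c"]
              span_scale[OF span_base[of "J u" "{u, J u}"], of c] by simp
        qed simp
        finally show ?thesis using that by blast
      qed
    qed simp
    then show ?thesis using span_pair_trace_zero[OF J] u JJ by auto
  qed
  \<comment> \<open>Up to scale, the average of the Euclidean product over the powers of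
    \<open>J\<close>. If \<open>J (J x) = - x\<close> on \<open>U\<close>, then \<open>J\<close>
    becomes an isometry and \<open>ip x (J x) = 0\<close>.\<close>
  define ip where "ip x y = x \<bullet> y + J x \<bullet> J y" for x y
  have ip: "inner_on U ip"
    unfolding inner_on_def ip_def bilinear_def linear_iff
    by (auto simp: linear_add[OF J] linear_cmul[OF J] inner_add_left inner_add_right
        inner_commute algebra_simps add_pos_nonneg)
  note bi = inner_onD(1)[OF ip]
  \<comment> \<open>Every unit vector qualifies, as the quadratic form of each \<open>A i\<close>
    vanishes on all of \<open>U\<close>.\<close>
  define B where "B = {x \<in> U. ip x x = 1}"
  have "span B = U"
  proof
    show "span B \<subseteq> U" using D(1) by (intro span_minimal) (auto simp: B_def)
    show "U \<subseteq> span B"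
    proof
      fix x assume x: "x \<in> U"
      show "x \<in> span B"
      proof (cases "x = 0")
        case False
        define r where "r = sqrt (ip x x)"
        have r: "r > 0" "ip x x = r * r" using inner_onD(3)[OF ip x False] by (simp_all add: r_def)
        have "(1 / r) *\<^sub>R x \<in> B"
          using x r D(1) by (simp add: B_def subspace_mul bilinear_lmul[OF bi] bilinear_rmul[OF bi] field_simps)
        then have "r *\<^sub>R (1 / r) *\<^sub>R x \<in> span B" by (intro span_scale span_base)
        then show ?thesis using r by simp
      qed (simp add: span_0)
    qed
  qed
  then have "unit_spanning ip U B" by (simp add: unit_spanning_def B_def)
  moreover have "ip e (A i e) = 0" if "e \<in> B" for i e
  proof -
    have e: "e \<in> U" using that by (simp add: B_def)
    obtain c where "A i e = c *\<^sub>R J e" using JA[of i] e by blast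
    moreover have "ip e (J e) = 0" using J2 e JU by (auto simp: ip_def linear_0[OF J] inner_commute)
    ultimately show ?thesis by (simp add: bilinear_rmul[OF bi])
  qed
  moreover have "trace_on U (A i) = 0" for i
  proof -
    obtain c where "\<forall>x\<in>U. A i x = c *\<^sub>R J x" using JA by blast
    then have "trace_on U (A i) = trace_on U (\<lambda>x. c *\<^sub>R J x)"
      using D(1) by (intro trace_on_cong) auto
    then show ?thesis by (simp add: trace_on_scaleR trace_J)
  qed
  ultimately show ?thesis using ip by blast
qed

text \<open>Induction along an invariant flag: a nonzero invariant \<open>U\<close> of least
  dimension is irreducible, and the quotient by \<open>U\<close> is modelled on a complement
  \<open>C\<close> with compressed operators \<open>A'\<close>. For \<open>e\<close> in
  \<open>C\<close> the \<open>U\<close>-component of \<open>A i e\<close> is orthogonal to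
  \<open>e\<close>, so \<open>A i\<close> and \<open>A' i\<close> have the same quadratic form
  there.\<close>

lemma commuting_imaginary_family:
  fixes A :: "'i \<Rightarrow> 'a::euclidean_space \<Rightarrow> 'a"
  assumes "commuting_family W A"
    and "\<And>i. \<exists>k. \<forall>x\<in>W. ((\<lambda>x. A i (A i x) + (b i)\<^sup>2 *\<^sub>R x) ^^ k) x = 0"
  shows "\<exists>ip B. inner_on W ip \<and> unit_spanning ip W B \<and>
    (\<forall>i. \<forall>e\<in>B. ip e (A i e) = 0) \<and> (\<forall>i. trace_on W (A i) = 0)"
  using assms
proof (induction "dim W" arbitrary: W A rule: less_induct)
  case less
  note D = commuting_familyD[OF less.prems(1)]
  define inv where "inv V \<longleftrightarrow> subspace V \<and> V \<subseteq> W \<and> V \<noteq> {0} \<and> (\<forall>i. \<forall>x\<in>V. A i x \<in> V)" for V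
  show ?case
  proof (cases "W = {0}")
    case True
    have "inner_on W (\<bullet>)"
      by (auto simp: inner_on_def bilinear_def linear_iff inner_add_left inner_add_right inner_commute)
    moreover have "unit_spanning (\<bullet>) W {}" using True by (simp add: unit_spanning_def)
    ultimately show ?thesis using trace_on_trivial[OF D(2)] True by blast
  next
    case False
    then have "inv W" using D by (auto simp: inv_def)
    then obtain U where U: "inv U" and least: "\<And>V. inv V \<Longrightarrow> dim U \<le> dim V"
      using ex_has_least_nat[of inv W dim] by blast
    have Us: "subspace U" "U \<subseteq> W" "U \<noteq> {0}" and UA: "\<And>i x. x \<in> U \<Longrightarrow> A i x \<in> U"
      using U by (auto simp: inv_def)
    have AU: "commuting_family U A" using commuting_family_subset[OF less.prems(1) Us(1,2) UA] .
    have "\<exists>ip B. inner_on U ip \<and> unit_spanning ip U B \<and>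
      (\<forall>i. \<forall>e\<in>B. ip e (A i e) = 0) \<and> (\<forall>i. trace_on U (A i) = 0)"
    proof (rule irreducible_imaginary_family[OF AU Us(3)])
      fix V assume V: "subspace V" "V \<subseteq> U" "V \<noteq> {0}" "\<And>i x. x \<in> V \<Longrightarrow> A i x \<in> V"
      then have "inv V" using Us(2) by (auto simp: inv_def)
      then show "V = U" using least V Us(1) by (intro subspace_dim_equal) auto
    next
      show "\<exists>k. \<forall>x\<in>U. ((\<lambda>x. A i (A i x) + (b i)\<^sup>2 *\<^sub>R x) ^^ k) x = 0" for i
        using less.prems(2)[of i] Us(2) by blast
    qed
    then obtain f BU where f: "inner_on U f" "unit_spanning f U BU"
      "\<And>i e. e \<in> BU \<Longrightarrow> f e (A i e) = 0" "\<And>i. trace_on U (A i) = 0" by blast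
    obtain P where P: "is_projection P U" using exists_projection_onto[OF Us(1)] by blast
    note Pl = is_projectionD(1)[OF P] and PU = is_projectionD(2)[OF P] and Pid = is_projectionD(3)[OF P]
    define C where "C = {x \<in> W. P x = 0}"
    define A' where "A' i x = A i x - P (A i x)" for i x
    have C: "subspace C" "C \<subseteq> W"
      using D(1) by (auto simp: C_def subspace_def linear_0[OF Pl] linear_add[OF Pl] linear_cmul[OF Pl])
    have QW: "x - P x \<in> C" if "x \<in> W" for x
      using that D(1) PU Us(2) Pid by (auto simp: C_def linear_diff[OF Pl] intro!: subspace_diff)
    \<comment> \<open>By invariance of \<open>U\<close>, compressing before applying
      \<open>A i\<close> as well makes no difference. So compression respects products, and
      \<open>A'\<close> inherits commutation and nilpotency.\<close>
    have QA: "A i (x - P x) - P (A i (x - P x)) = A i x - P (A i x)" for i x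
      using Pid[OF UA[OF PU]] by (simp add: linear_diff[OF D(2)] linear_diff[OF Pl])
    have lin: "linear (A' i)" for i
      unfolding A'_def linear_iff
      by (simp add: linear_add[OF D(2)] linear_cmul[OF D(2)] linear_add[OF Pl] linear_cmul[OF Pl] algebra_simps)
    have A'C: "A' i x \<in> C" if "x \<in> C" for i x
      unfolding A'_def using that C D(3) by (intro QW) auto
    have A'Q: "A' i (x - P x) = A i x - P (A i x)" for i x
      using QA by (simp add: A'_def)
    have comm: "commuting_family C A'"
      unfolding commuting_family_def
    proof (intro conjI allI ballI C lin A'C)
      fix i j x assume "x \<in> C"
      then have "A i (A j x) = A j (A i x)" using D(4) C by blast
      moreover have "A' i (A' j x) = A i (A j x) - P (A i (A j x))" for i j
        unfolding A'_def[of j] A'Q ..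
      ultimately show "A' i (A' j x) = A' j (A' i x)" by simp
    qed
    have nil: "\<exists>k. \<forall>x\<in>C. ((\<lambda>x. A' i (A' i x) + (b i)\<^sup>2 *\<^sub>R x) ^^ k) x = 0" for i
    proof -
      let ?T = "\<lambda>x. A i (A i x) + (b i)\<^sup>2 *\<^sub>R x" and ?T' = "\<lambda>x. A' i (A' i x) + (b i)\<^sup>2 *\<^sub>R x"
      obtain k where k: "\<And>x. x \<in> W \<Longrightarrow> (?T ^^ k) x = 0" using less.prems(2)[of i] by blast
      have step: "?T' (x - P x) = ?T x - P (?T x)" for x
        unfolding A'Q
        by (simp add: linear_add[OF Pl] linear_cmul[OF Pl] algebra_simps)
      have pow: "(?T' ^^ j) (x - P x) = (?T ^^ j) x - P ((?T ^^ j) x)" for j x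
        by (induction j) (simp_all only: funpow.simps o_apply id_apply step)
      have "(?T' ^^ k) x = 0" if "x \<in> C" for x
      proof -
        have "x \<in> W" "P x = 0" using that by (simp_all add: C_def)
        then show ?thesis using pow[of k x] k by (simp add: linear_0[OF Pl])
      qed
      then show ?thesis by blast
    qed
    have "C \<noteq> W"
    proof
      assume "C = W"
      then have "x = 0" if "x \<in> U" for x using that Us(2) Pid[OF that] by (force simp: C_def)
      then show False using Us subspace_0 by blast
    qed
    then have "dim C < dim W" using C D(1) by (metis dim_subset le_neq_implies_less subspace_dim_equal order_refl)
    from less.hyps[OF this comm nil] obtain g BC where
      g: "inner_on C g" "unit_spanning g C BC"
      "\<And>i e. e \<in> BC \<Longrightarrow> g e (A' i e) = 0" "\<And>i. trace_on C (A' i) = 0" by blast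
    define ip where "ip x y = f (P x) (P y) + g (x - P x) (y - P y)" for x y
    have ip: "inner_on W ip"
      unfolding ip_def using inner_on_glue[OF D(1) Us(2) P f(1)] g(1) by (simp add: C_def)
    note z = bilinear_lzero[OF inner_onD(1)[OF f(1)]] bilinear_lzero[OF inner_onD(1)[OF g(1)]]
    have onU: "ip e y = f e (P y)" if "e \<in> U" for e y using Pid[OF that] z by (simp add: ip_def)
    have onC: "ip e y = g e (y - P y)" if "e \<in> C" for e y using that z by (simp add: ip_def C_def)
    note BU = unit_spanningD[OF f(2)] and BC = unit_spanningD[OF g(2)]
    have "span (BU \<union> BC) = W"
    proof
      show "span (BU \<union> BC) \<subseteq> W" using BU(1) BC(1) Us(2) C(2) D(1) by (intro span_minimal) auto
      show "W \<subseteq> span (BU \<union> BC)"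
      proof
        fix x assume "x \<in> W"
        then have "P x \<in> span BU" "x - P x \<in> span BC" using PU QW BU(2) BC(2) by auto
        then have "P x + (x - P x) \<in> span (BU \<union> BC)"
          using span_mono[of BU "BU \<union> BC"] span_mono[of BC "BU \<union> BC"] by (intro span_add) auto
        then show "x \<in> span (BU \<union> BC)" by simp
      qed
    qed
    moreover have "ip e e = 1" if "e \<in> BU \<union> BC" for e
      using that BU BC Pid[of e] by (auto simp: onU onC subset_iff C_def)
    ultimately have "unit_spanning ip W (BU \<union> BC)" by (simp add: unit_spanning_def)
    moreover have "ip e (A i e) = 0" if "e \<in> BU \<union> BC" for i e
      using that
    proof
      assume e: "e \<in> BU"
      then have "e \<in> U" using BU(1) by blast
      then show ?thesis using f(3)[OF e] Pid[OF UA] by (simp add: onU)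
    next
      assume e: "e \<in> BC"
      then have "e \<in> C" using BC(1) by blast
      then show ?thesis using g(3)[OF e] by (simp add: onC A'_def)
    qed
    moreover have "trace_on W (A i) = 0" for i
      using trace_on_split[OF D(1) Us(2) P D(2,3) UA] f(4)[of i] g(4)[of i]
      by (simp add: C_def A'_def[abs_def])
    ultimately show ?thesis using ip by blast
  qed
qed

text \<open>Here \<open>trace_on W (\<lambda>x. x)\<close> plays the role of \<open>dim W\<close>.\<close>

lemma commuting_family_balanced:
  fixes A :: "'i \<Rightarrow> 'a::euclidean_space \<Rightarrow> 'a"
  assumes "commuting_family W A"
  shows "\<exists>ip B. inner_on W ip \<and> unit_spanning ip W B \<and>
    (\<forall>i. \<forall>e\<in>B. ip e (A i e) * trace_on W (\<lambda>x. x) = trace_on W (A i))"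
  using assms
proof (induction "dim W" arbitrary: W rule: less_induct)
  case less
  note D = commuting_familyD[OF less.prems]
  show ?case
  proof (cases "\<exists>U C. subspace U \<and> subspace C \<and> U \<subseteq> W \<and> C \<subseteq> W \<and> U \<noteq> {0} \<and> C \<noteq> {0} \<and> U \<inter> C = {0} \<and>
      (\<forall>w\<in>W. \<exists>u\<in>U. w - u \<in> C) \<and> (\<forall>i. \<forall>x\<in>U. A i x \<in> U) \<and> (\<forall>i. \<forall>x\<in>C. A i x \<in> C)")
    case True
    then obtain U C where U: "subspace U" "U \<subseteq> W" "U \<noteq> {0}" and C: "subspace C" "C \<subseteq> W" "C \<noteq> {0}"
      and UC: "U \<inter> C = {0}" "\<And>w. w \<in> W \<Longrightarrow> \<exists>u\<in>U. w - u \<in> C"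
      and UA: "\<And>i x. x \<in> U \<Longrightarrow> A i x \<in> U" and CA: "\<And>i x. x \<in> C \<Longrightarrow> A i x \<in> C"
      by metis
    obtain P where P: "is_projection P U" and PC: "\<And>x. x \<in> C \<Longrightarrow> P x = 0"
      using exists_projection[OF U(1) C(1) UC(1)] by blast
    note Pl = is_projectionD(1)[OF P] and PU = is_projectionD(2)[OF P] and Pid = is_projectionD(3)[OF P]
    have QW: "x - P x \<in> C" if x: "x \<in> W" for x
    proof -
      obtain u where u: "u \<in> U" "x - u \<in> C" using UC(2)[OF x] by blast
      then have "P x = u" using PC[OF u(2)] Pid[OF u(1)] by (simp add: linear_diff[OF Pl])
      then show ?thesis using u by simp
    qed
    have Ceq: "C = {x \<in> W. P x = 0}" using QW PC C(2) by force
    have "C \<noteq> W" "U \<noteq> W" using UC(1) U C by auto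
    then have "dim U < dim W" "dim C < dim W"
      using U C D(1) by (metis dim_subset le_neq_implies_less subspace_dim_equal order_refl)+
    with less.hyps[OF _ commuting_family_subset[OF less.prems]] U C UA CA
    obtain f BU g BC where f: "inner_on U f" "unit_spanning f U BU"
      "\<And>i e. e \<in> BU \<Longrightarrow> f e (A i e) * trace_on U (\<lambda>x. x) = trace_on U (A i)"
      and g: "inner_on C g" "unit_spanning g C BC"
      "\<And>i e. e \<in> BC \<Longrightarrow> g e (A i e) * trace_on C (\<lambda>x. x) = trace_on C (A i)"
      by metis
    define p q where "p = trace_on U (\<lambda>x. x)" and "q = trace_on C (\<lambda>x. x)"
    have pq: "p > 0" "q > 0" unfolding p_def q_def using U C trace_on_id_pos by auto
    have split: "trace_on W S = trace_on U S + trace_on C S"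
      if "linear S" "\<And>x. x \<in> W \<Longrightarrow> S x \<in> W" "\<And>x. x \<in> U \<Longrightarrow> S x \<in> U" "\<And>x. x \<in> C \<Longrightarrow> S x \<in> C" for S
    proof -
      have "trace_on C (\<lambda>x. S x - P (S x)) = trace_on C S"
        using C(1) PC that(4) by (intro trace_on_cong) auto
      then show ?thesis using trace_on_split[OF D(1) U(2) P that(1-3)] Ceq by simp
    qed
    define ip where "ip x y = f (P x) (P y) + g (x - P x) (y - P y)" for x y
    have ip: "inner_on W ip"
      unfolding ip_def using inner_on_glue[OF D(1) U(2) P f(1)] g(1) Ceq by simp
    note fb = inner_onD(1)[OF f(1)] and gb = inner_onD(1)[OF g(1)]
    have ip_eq: "ip (x + y) (x' + y') = f x x' + g y y'" if "x \<in> U" "y \<in> C" "x' \<in> U" "y' \<in> C" for x y x' y'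
      using that by (simp add: ip_def linear_add[OF Pl] Pid PC)
    note BU = unit_spanningD[OF f(2)] and BC = unit_spanningD[OF g(2)]
    \<comment> \<open>The squared weights are the shares of \<open>U\<close> and \<open>C\<close> in
      the dimension of \<open>W\<close>. They add up to 1, which preserves unit length, and the mean
      they form of the averages of \<open>A i\<close> on \<open>U\<close> and \<open>C\<close> is
      its average on \<open>W\<close>.\<close>
    define \<alpha> \<beta> where "\<alpha> = sqrt (p / (p + q))" and "\<beta> = sqrt (q / (p + q))"
    have \<alpha>: "\<alpha> > 0" "\<alpha> * \<alpha> = p / (p + q)" and \<beta>: "\<beta> > 0" "\<beta> * \<beta> = q / (p + q)"
      using pq by (simp_all add: \<alpha>_def \<beta>_def)
    \<comment> \<open>With both signs of \<open>\<beta>\<close> present, sums and differences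
      recover \<open>e\<close> and \<open>e'\<close> separately.\<close>
    define B where "B = {\<alpha> *\<^sub>R e + s *\<^sub>R e' |e e' s. e \<in> BU \<and> e' \<in> BC \<and> (s = \<beta> \<or> s = - \<beta>)}"
    have BW: "B \<subseteq> W"
      using BU(1) BC(1) U(2) C(2) D(1) by (auto simp: B_def intro!: subspace_add subspace_mul)
    have mem: "e \<in> span B \<and> e' \<in> span B" if "e \<in> BU" "e' \<in> BC" for e e'
    proof -
      have 1: "\<alpha> *\<^sub>R e + \<beta> *\<^sub>R e' \<in> span B" "\<alpha> *\<^sub>R e + (- \<beta>) *\<^sub>R e' \<in> span B"
        unfolding B_def using that by (blast intro: span_base)+
      have "(1 / (2 * \<alpha>)) *\<^sub>R ((\<alpha> *\<^sub>R e + \<beta> *\<^sub>R e') + (\<alpha> *\<^sub>R e + (- \<beta>) *\<^sub>R e')) \<in> span B"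
        "(1 / (2 * \<beta>)) *\<^sub>R ((\<alpha> *\<^sub>R e + \<beta> *\<^sub>R e') - (\<alpha> *\<^sub>R e + (- \<beta>) *\<^sub>R e')) \<in> span B"
        using 1 by (simp_all only: span_scale span_add span_diff)
      moreover have "(1 / (2 * \<alpha>)) *\<^sub>R ((\<alpha> *\<^sub>R e + \<beta> *\<^sub>R e') + (\<alpha> *\<^sub>R e + (- \<beta>) *\<^sub>R e')) = e"
        "(1 / (2 * \<beta>)) *\<^sub>R ((\<alpha> *\<^sub>R e + \<beta> *\<^sub>R e') - (\<alpha> *\<^sub>R e + (- \<beta>) *\<^sub>R e')) = e'"
        using \<alpha>(1) \<beta>(1) by (simp_all add: scaleR_add_right[symmetric] scaleR_2[symmetric])
      ultimately show ?thesis by simp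
    qed
    \<comment> \<open>Each vector of \<open>BU\<close> needs a partner in \<open>BC\<close>, and
      conversely.\<close>
    have ne: "BU \<noteq> {}" "BC \<noteq> {}" using BU(2) BC(2) U(3) C(3) by auto
    have "BU \<union> BC \<subseteq> span B" using mem ne by blast
    have "span B = W"
    proof
      show "span B \<subseteq> W" using BW D(1) by (rule span_minimal)
      show "W \<subseteq> span B"
      proof
        fix x assume "x \<in> W"
        then have "P x \<in> span BU" "x - P x \<in> span BC" using PU QW BU(2) BC(2) by auto
        moreover have "span BU \<subseteq> span B" "span BC \<subseteq> span B"
          using \<open>BU \<union> BC \<subseteq> span B\<close> by (intro span_minimal; simp)+
        ultimately have "P x + (x - P x) \<in> span B" by (intro span_add) auto
        then show "x \<in> span B" by simp
      qed
    qed
    have unit_balanced: "ip e e = 1 \<and> ip e (A i e) * trace_on W (\<lambda>x. x) = trace_on W (A i)" if e: "e \<in> B" for e i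
    proof -
      obtain v w s where e: "e = \<alpha> *\<^sub>R v + s *\<^sub>R w" and v: "v \<in> BU" and w: "w \<in> BC" and "s = \<beta> \<or> s = - \<beta>"
        using e unfolding B_def by blast
      then have s: "s * s = \<beta> * \<beta>" by auto
      have vU: "v \<in> U" and wC: "w \<in> C" using v w BU(1) BC(1) by auto
      have "ip e e = \<alpha> * \<alpha> * f v v + s * s * g w w"
        unfolding e using vU wC U(1) C(1)
        by (simp add: ip_eq subspace_mul bilinear_lmul[OF fb] bilinear_rmul[OF fb]
            bilinear_lmul[OF gb] bilinear_rmul[OF gb])
      also have "\<dots> = 1" using BU(3)[OF v] BC(3)[OF w] \<alpha> \<beta> s pq by (simp add: add_divide_distrib[symmetric])
      finally have "ip e e = 1" .
      have "ip e (A i e) = \<alpha> * \<alpha> * f v (A i v) + s * s * g w (A i w)"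
        unfolding e using vU wC U(1) C(1) UA[OF vU] CA[OF wC]
        by (simp add: linear_add[OF D(2)] linear_cmul[OF D(2)] ip_eq subspace_mul bilinear_lmul[OF fb]
            bilinear_rmul[OF fb] bilinear_lmul[OF gb] bilinear_rmul[OF gb])
      also have "\<dots> = (f v (A i v) * p + g w (A i w) * q) / (p + q)"
        unfolding s \<alpha> \<beta> by (simp add: add_divide_distrib mult.commute)
      also have "\<dots> = trace_on W (A i) / (p + q)"
        using f(3)[OF v] g(3)[OF w] split[OF D(2,3) UA CA] by (simp add: p_def q_def)
      finally have "ip e (A i e) * (p + q) = trace_on W (A i)" using pq by simp
      moreover have "trace_on W (\<lambda>x. x) = p + q"
        unfolding p_def q_def using linear_id by (intro split) (auto simp: id_def)
      ultimately show ?thesis using \<open>ip e e = 1\<close> by simp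
    qed
    then have "unit_spanning ip W B" using \<open>span B = W\<close> by (simp add: unit_spanning_def)
    then show ?thesis using ip unit_balanced by blast
  next
    case indec: False
    \<comment> \<open>Nilpotency of (A i - a)^2 + b^2 on \<open>W\<close>, spelled out exactly as
      the shifted operator \<open>A'\<close> below unfolds.\<close>
    define nilp where "nilp i a b \<longleftrightarrow> (\<exists>k. \<forall>x\<in>W.
      ((\<lambda>x. (A i (A i x - a *\<^sub>R x) - a *\<^sub>R (A i x - a *\<^sub>R x)) + b\<^sup>2 *\<^sub>R x) ^^ k) x = 0)" for i a b
    have "\<exists>a b. nilp i a b" for i
    proof (cases "W = {0}")
      case True
      then have "nilp i 0 0" unfolding nilp_def by (intro exI[of _ 0]) simp
      then show ?thesis by blast
    next
      case False
      obtain a b y where y: "y \<in> W" "y \<noteq> 0" "A i (A i y) - (2 * a) *\<^sub>R A i y + (a\<^sup>2 + b\<^sup>2) *\<^sub>R y = 0"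
        using exists_singular_quadratic[OF D(2) D(1) False D(3)] by blast
      define T where "T x = (A i (A i x - a *\<^sub>R x) - a *\<^sub>R (A i x - a *\<^sub>R x)) + b\<^sup>2 *\<^sub>R x" for x
      have lin: "linear T"
        unfolding T_def linear_iff
        by (simp add: linear_add[OF D(2)] linear_diff[OF D(2)] linear_cmul[OF D(2)] algebra_simps)
      have TW: "T x \<in> W" if "x \<in> W" for x
        using that D(1,3) by (simp add: T_def subspace_add subspace_diff subspace_mul)
      have TA: "T (A j x) = A j (T x)" if "x \<in> W" for j x
        using that D(3) D(4)[of _ i j]
        by (simp add: T_def linear_add[OF D(2)] linear_diff[OF D(2)] linear_cmul[OF D(2)])
      have "(2 * a) *\<^sub>R A i y = a *\<^sub>R A i y + a *\<^sub>R A i y"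
        unfolding mult_2 by (rule scaleR_add_left)
      then have Ty: "T y = 0"
        using y(3) by (simp add: T_def linear_diff[OF D(2)] linear_cmul[OF D(2)] algebra_simps power2_eq_square)
      obtain k where "k > 0" and k: "{x \<in> W. (T ^^ k) x = 0} \<inter> (T ^^ k) ` W = {0}"
        "\<And>w. w \<in> W \<Longrightarrow> \<exists>u\<in>W. (T ^^ k) (w - (T ^^ k) u) = 0"
        using fitting_decomposition[OF lin D(1) TW] by blast
      define K I where "K = {x \<in> W. (T ^^ k) x = 0}" and "I = (T ^^ k) ` W"
      note linT = linear_funpow[OF lin, of k]
      have TkW: "(T ^^ m) x \<in> W" if "x \<in> W" for x m using that TW by (induction m) auto
      have TkA: "(T ^^ m) (A j x) = A j ((T ^^ m) x)" if "x \<in> W" for j x m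
        using that TA TkW by (induction m) auto
      have K: "subspace K" "K \<subseteq> W"
        using D(1) by (auto simp: K_def subspace_def linear_0[OF linT] linear_add[OF linT] linear_cmul[OF linT])
      have I: "subspace I" "I \<subseteq> W"
        using linear_subspace_image[OF linT D(1)] TkW by (auto simp: I_def)
      \<comment> \<open>Both Fitting parts of \<open>T\<close> are invariant under the family, and
        \<open>K\<close> is nonzero because it contains \<open>y\<close>; a nonzero \<open>I\<close>
        would split \<open>W\<close>.\<close>
      have "I = {0}"
      proof (rule ccontr)
        assume "I \<noteq> {0}"
        obtain m where "k = Suc m" using \<open>k > 0\<close> gr0_implies_Suc by blast
        then have "(T ^^ k) y = 0"
          using Ty linear_0[OF linear_funpow[OF lin, of m]]
          by (simp add: funpow_Suc_right del: funpow.simps)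
        then have "K \<noteq> {0}" using y by (auto simp: K_def)
        moreover have "\<exists>u\<in>I. w - u \<in> K" if w: "w \<in> W" for w
        proof -
          obtain u where u: "u \<in> W" "(T ^^ k) (w - (T ^^ k) u) = 0" using k(2)[OF w] by blast
          then have "w - (T ^^ k) u \<in> K" using w D(1) TkW by (simp add: K_def subspace_diff)
          then show ?thesis using u by (auto simp: I_def)
        qed
        moreover have "A j x \<in> I" if x: "x \<in> I" for j x
        proof -
          obtain w where "w \<in> W" "x = (T ^^ k) w" using x by (auto simp: I_def)
          then show ?thesis using D(3) TkA[of w k j] unfolding I_def by (metis image_eqI)
        qed
        moreover have "A j x \<in> K" if "x \<in> K" for j x
          using that D(3) TkA[of x k j] linear_0[OF D(2)] by (auto simp: K_def)
        moreover have "I \<inter> K = {0}" using k(1) by (auto simp: K_def I_def)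
        ultimately show False
          using K I \<open>I \<noteq> {0}\<close>
          by - (rule notE[OF indec], intro exI[of _ I] exI[of _ K] conjI allI ballI, simp_all)
      qed
      then have "\<forall>x\<in>W. (T ^^ k) x = 0" by (auto simp: I_def)
      then show ?thesis unfolding T_def nilp_def by blast
    qed
    then obtain a b where nil: "\<And>i. nilp i (a i) (b i)" by metis
    \<comment> \<open>Removing the real parts leaves purely imaginary eigenvalues. The scalar
      \<open>a i\<close> is then both the average of \<open>A i\<close> on \<open>W\<close> and its
      quadratic form at the vectors of \<open>B\<close>.\<close>
    define A' where "A' i x = A i x - a i *\<^sub>R x" for i x
    have "commuting_family W A'"
      unfolding commuting_family_def
    proof (intro conjI allI ballI D(1))
      show "linear (A' i)" for i
        unfolding A'_def linear_iff
        by (simp add: linear_add[OF D(2)] linear_cmul[OF D(2)] algebra_simps)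
      show "A' i x \<in> W" if "x \<in> W" for i x using that D by (simp add: A'_def subspace_diff subspace_mul)
      show "A' i (A' j x) = A' j (A' i x)" if "x \<in> W" for i j x
        using D(4)[OF that, of i j]
        by (simp add: A'_def linear_diff[OF D(2)] linear_cmul[OF D(2)] algebra_simps)
    qed
    moreover have "\<exists>k. \<forall>x\<in>W. ((\<lambda>x. A' i (A' i x) + (b i)\<^sup>2 *\<^sub>R x) ^^ k) x = 0" for i
      using nil[of i] unfolding nilp_def A'_def .
    ultimately obtain ip B where ip: "inner_on W ip" "unit_spanning ip W B"
      "\<And>i e. e \<in> B \<Longrightarrow> ip e (A' i e) = 0" "\<And>i. trace_on W (A' i) = 0"
      using commuting_imaginary_family[of W A' b] by blast
    note bi = inner_onD(1)[OF ip(1)]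
    have "ip e (A i e) * trace_on W (\<lambda>x. x) = trace_on W (A i)" if e: "e \<in> B" for i e
    proof -
      have "A i = (\<lambda>x. A' i x + a i *\<^sub>R x)" by (simp add: A'_def fun_eq_iff)
      then have "ip e (A i e) = a i" "trace_on W (A i) = a i * trace_on W (\<lambda>x. x)"
        using ip(3)[OF e, of i] ip(4)[of i] unit_spanningD(3)[OF ip(2) e]
        by (simp_all add: bilinear_radd[OF bi] bilinear_rmul[OF bi] trace_on_add trace_on_scaleR)
      then show ?thesis by simp
    qed
    then show ?thesis using ip(1,2) by blast
  qed
qed

section \<open>The derived algebra lies in an abelian nilradical\<close>

text \<open>Take \<open>L'\<close> proper, invariant and of greatest dimension. If
  \<open>L' + A i L\<close> were all of \<open>L\<close>, iteration would give
  \<open>L = L' + (A i)^k L\<close> for every \<open>k\<close>, and nilpotency would force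
  \<open>L = L'\<close>. So the sum is proper, and by maximality it equals
  \<open>L'\<close>.\<close>

lemma commuting_nilpotent_proper:
  fixes A :: "'i \<Rightarrow> 'a::euclidean_space \<Rightarrow> 'a"
  assumes L: "subspace L" "L \<noteq> {0}"
    and lin: "\<And>i. i \<in> S \<Longrightarrow> linear (A i)"
    and inv: "\<And>i x. i \<in> S \<Longrightarrow> x \<in> L \<Longrightarrow> A i x \<in> L"
    and comm: "\<And>i j x. i \<in> S \<Longrightarrow> j \<in> S \<Longrightarrow> x \<in> L \<Longrightarrow> A i (A j x) = A j (A i x)"
    and nil: "\<And>i. i \<in> S \<Longrightarrow> \<exists>k. \<forall>x\<in>L. (A i ^^ k) x = 0"
  shows "\<exists>L'. subspace L' \<and> L' \<subset> L \<and> (\<forall>i\<in>S. \<forall>x\<in>L. A i x \<in> L')"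
proof -
  define Q where "Q V \<longleftrightarrow> subspace V \<and> V \<subset> L \<and> (\<forall>i\<in>S. \<forall>x\<in>V. A i x \<in> V)" for V
  have "Q {0}" using L lin subspace_0[OF L(1)] by (auto simp: Q_def subspace_single_0 linear_0)
  moreover have "\<forall>V. Q V \<longrightarrow> dim V < Suc DIM('a)" by (simp add: dim_subset_UNIV le_imp_less_Suc)
  ultimately obtain L' where L': "Q L'" and greatest: "\<And>V. Q V \<Longrightarrow> dim V \<le> dim L'"
    using ex_has_greatest_nat[of Q "{0}" dim "Suc DIM('a)"] by blast
  have sub: "subspace L'" "L' \<subset> L" and L'_inv: "\<And>i x. i \<in> S \<Longrightarrow> x \<in> L' \<Longrightarrow> A i x \<in> L'"
    using L' by (auto simp: Q_def)
  have "A i y \<in> L'" if i: "i \<in> S" and y: "y \<in> L" for i y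
  proof -
    define V where "V = {x + z |x z. x \<in> L' \<and> z \<in> A i ` L}"
    have V: "subspace V"
      unfolding V_def by (rule subspace_sums[OF sub(1) linear_subspace_image[OF lin[OF i] L(1)]])
    have VL: "V \<subseteq> L" using sub(2) inv[OF i] L(1) by (auto simp: V_def intro!: subspace_add)
    have zero: "0 \<in> A i ` L" using subspace_0[OF linear_subspace_image[OF lin[OF i] L(1)]] .
    have L'V: "L' \<subseteq> V"
    proof
      fix x assume "x \<in> L'"
      then have "x + 0 \<in> V" unfolding V_def using zero by blast
      then show "x \<in> V" by simp
    qed
    have V_inv: "A j v \<in> V" if "j \<in> S" "v \<in> V" for j v
    proof -
      obtain x z where v: "v = x + A i z" "x \<in> L'" "z \<in> L" using \<open>v \<in> V\<close> by (auto simp: V_def)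
      then have "A j v = A j x + A i (A j z)"
        using comm[OF i \<open>j \<in> S\<close> v(3)] lin[OF \<open>j \<in> S\<close>] by (simp add: linear_add)
      moreover have "A j x \<in> L'" "A j z \<in> L" using v L'_inv inv \<open>j \<in> S\<close> by auto
      ultimately show ?thesis unfolding V_def by blast
    qed
    have "V \<noteq> L"
    proof
      assume VeqL: "V = L"
      have L'_pow: "(A i ^^ k) x \<in> L'" if "x \<in> L'" for k x
        using that L'_inv[OF i] by (induction k) auto
      have "\<exists>x\<in>L'. \<exists>z\<in>L. w = x + (A i ^^ k) z" if "w \<in> L" for w k
        using that
      proof (induction k arbitrary: w)
        case 0
        then show ?case using subspace_0[OF sub(1)] by force
      next
        case (Suc k)
        then obtain x z where xz: "x \<in> L'" "z \<in> L" "w = x + (A i ^^ k) z" by blast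
        have "z \<in> V" using xz VeqL by simp
        then obtain x' z' where z: "x' \<in> L'" "z' \<in> L" "z = x' + A i z'"
          by (auto simp: V_def)
        have "w = (x + (A i ^^ k) x') + (A i ^^ Suc k) z'"
          using xz z linear_add[OF linear_funpow[OF lin[OF i]]] by (simp add: funpow_swap1)
        moreover have "x + (A i ^^ k) x' \<in> L'" using xz z L'_pow sub(1) by (simp add: subspace_add)
        ultimately show ?case using z by blast
      qed
      moreover obtain k where "\<forall>x\<in>L. (A i ^^ k) x = 0" using nil[OF i] by blast
      ultimately have "w \<in> L'" if "w \<in> L" for w using that by (metis add.right_neutral)
      then have "L \<subseteq> L'" by blast
      then show False using sub by blast
    qed
    then have "Q V" using V VL V_inv by (auto simp: Q_def)
    then have "L' = V" using subspace_dim_equal[OF sub(1) V L'V] greatest by blast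
    have "0 + A i y \<in> V" unfolding V_def using y subspace_0[OF sub(1)] by blast
    then show ?thesis using \<open>L' = V\<close> by simp
  qed
  then show ?thesis using sub by blast
qed

section \<open>Brackets, ideals and nilpotent actions\<close>

lemma lie_algebraD:
  assumes "lie_algebra br"
  shows "bilinear br" "br x y = - br y x" "br (br x y) z = br x (br y z) - br y (br x z)"
proof -
  show b: "bilinear br" using assms by (simp add: lie_algebra_def)
  have sq: "br x x = 0" for x using assms by (simp add: lie_algebra_def)
  have anti: "br x y = - br y x" for x y
    using sq[of "x + y"] sq[of x] sq[of y]
    by (simp add: bilinear_ladd[OF b] bilinear_radd[OF b] eq_neg_iff_add_eq_0 add.commute)
  show "br x y = - br y x" by (rule anti)
  have "br x (br y z) + br y (br z x) + br z (br x y) = 0" using assms by (simp add: lie_algebra_def)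
  then show "br (br x y) z = br x (br y z) - br y (br x z)"
    using anti[of z x] anti[of z "br x y"] by (simp add: bilinear_rneg[OF b] algebra_simps)
qed

lemma bilinear_span_mem:
  assumes br: "bilinear br" and V: "subspace V"
    and mem: "\<And>x y. x \<in> X \<Longrightarrow> y \<in> Y \<Longrightarrow> br x y \<in> V" and x: "x \<in> span X" and y: "y \<in> span Y"
  shows "br x y \<in> V"
  using x
proof (induction rule: span_induct)
  case base
  show ?case
    using V by (auto simp: subspace_def bilinear_lzero[OF br] bilinear_ladd[OF br] bilinear_lmul[OF br])
next
  case (step x)
  show ?case
    using y
  proof (induction rule: span_induct)
    case base
    show ?case
      using V by (auto simp: subspace_def bilinear_rzero[OF br] bilinear_radd[OF br] bilinear_rmul[OF br])
  next
    case (step y)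
    then show ?case using mem \<open>x \<in> X\<close> by blast
  qed
qed

lemma bracket_span_mono: "T \<subseteq> T' \<Longrightarrow> bracket_span br S T \<subseteq> bracket_span br S T'"
  unfolding bracket_span_def by (intro span_mono) blast

lemma lie_ideal_span:
  assumes br: "bilinear br" and mem: "\<And>x y. y \<in> Y \<Longrightarrow> br x y \<in> span Y"
  shows "lie_ideal br (span Y)"
  unfolding lie_ideal_def
proof (intro conjI allI impI)
  fix x y assume "y \<in> span Y"
  then show "br x y \<in> span Y"
    using bilinear_span_mem[OF br subspace_span, of UNIV Y Y] mem span_UNIV by auto
qed simp

text \<open>Each \<open>br z\<close> is a derivation, so it sends a bracket to a sum of brackets of
  the same kind.\<close>

lemma lie_ideal_bracket_span:
  assumes lie: "lie_algebra br" and I: "lie_ideal br I" and K: "lie_ideal br K"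
  shows "lie_ideal br (bracket_span br I K)"
  unfolding bracket_span_def
proof (rule lie_ideal_span[OF lie_algebraD(1)[OF lie]])
  fix z w assume "w \<in> {br x y |x y. x \<in> I \<and> y \<in> K}"
  then obtain x y where w: "w = br x y" "x \<in> I" "y \<in> K" by blast
  have "br z w = br (br z x) y + br x (br z y)"
    using lie_algebraD(3)[OF lie, of z x y] w by simp
  moreover have "br z x \<in> I" "br z y \<in> K" using w I K by (auto simp: lie_ideal_def)
  then have "br (br z x) y \<in> {br x y |x y. x \<in> I \<and> y \<in> K}" "br x (br z y) \<in> {br x y |x y. x \<in> I \<and> y \<in> K}"
    using w by blast+
  ultimately show "br z w \<in> span {br x y |x y. x \<in> I \<and> y \<in> K}"
    by (simp only: span_add span_base)
qed

text \<open>Brackets of the span land in \<open>N\<close>, on which \<open>N\<close> acts as zero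
  and \<open>S\<close> acts by nilpotent maps; these commute because \<open>br s t\<close> lies in
  \<open>N\<close>. Hence \<open>commuting_nilpotent_proper\<close> shrinks every further term of
  the lower central series.\<close>

lemma nilpotent_sub_span_nilpotent_action:
  fixes br :: "'a::euclidean_space \<Rightarrow> 'a \<Rightarrow> 'a"
  assumes lie: "lie_algebra br" and N: "lie_ideal br N" "abelian_sub br N"
    and M: "lie_ideal br (span (S \<union> N))"
    and SS: "\<And>s t. s \<in> S \<Longrightarrow> t \<in> S \<Longrightarrow> br s t \<in> N"
    and nil: "\<And>s. s \<in> S \<Longrightarrow> \<exists>k. \<forall>v\<in>N. (br s ^^ k) v = 0"
  shows "nilpotent_sub br (span (S \<union> N))"
proof -
  note br = lie_algebraD(1)[OF lie]
  let ?M = "span (S \<union> N)"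
  have Nsub: "subspace N" and NI: "\<And>x y. y \<in> N \<Longrightarrow> br x y \<in> N" using N(1) by (auto simp: lie_ideal_def)
  have NI': "br x y \<in> N" if "x \<in> N" for x y
    using NI[OF that, of y] lie_algebraD(2)[OF lie, of x y] subspace_neg[OF Nsub] by metis
  have abel: "br x y = 0" if "x \<in> N" "y \<in> N" for x y using N(2) that by (auto simp: abelian_sub_def)
  \<comment> \<open>The index is shifted by one because the first bracket already lies in
    \<open>N\<close>, while the ideal itself need not.\<close>
  define L where "L j = lower_central br ?M (Suc j)" for j
  have L_Suc: "L (Suc j) = bracket_span br ?M (L j)" for j by (simp add: L_def)
  have Lsub: "subspace (L j)" for j by (simp add: L_def bracket_span_def)
  have LN: "L j \<subseteq> N" for j
  proof (induction j)
    case 0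
    have "br x y \<in> N" if "x \<in> S \<union> N" "y \<in> S \<union> N" for x y
      using that SS NI NI' by blast
    then have "br x y \<in> N" if "x \<in> ?M" "y \<in> ?M" for x y
      using bilinear_span_mem[OF br Nsub _ that] by blast
    then show ?case
      using Nsub unfolding L_def lower_central.simps bracket_span_def by (intro span_minimal) auto
  next
    case (Suc j)
    then show ?case using Nsub NI unfolding L_Suc bracket_span_def by (intro span_minimal) auto
  qed
  have anti: "L (Suc j) \<subseteq> L j" for j
  proof (induction j)
    case 0
    have "bracket_span br ?M ?M \<subseteq> ?M"
      using M unfolding bracket_span_def lie_ideal_def by (intro span_minimal) auto
    then show ?case unfolding L_def lower_central.simps by (rule bracket_span_mono)
  next
    case (Suc j)
    then show ?case unfolding L_Suc[of "Suc j"] L_Suc[of j] by (rule bracket_span_mono)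
  qed
  have L_inv: "br s v \<in> L j" if "s \<in> S" "v \<in> L j" for s v j
  proof -
    have "s \<in> ?M" using that by (simp add: span_base)
    then have "br s v \<in> L (Suc j)" unfolding L_Suc bracket_span_def using that(2) by (intro span_base) blast
    then show ?thesis using anti by blast
  qed
  have decrease: "dim (L (Suc j)) < dim (L j)" if ne: "L j \<noteq> {0}" for j
  proof -
    have "\<exists>L'. subspace L' \<and> L' \<subset> L j \<and> (\<forall>s\<in>S. \<forall>x\<in>L j. br s x \<in> L')"
    proof (rule commuting_nilpotent_proper[OF Lsub ne])
      show "linear (br s)" for s using br by (simp add: bilinear_def)
      show "br s (br t x) = br t (br s x)" if "s \<in> S" "t \<in> S" "x \<in> L j" for s t x
      proof -
        have "x \<in> N" using that LN by blast
        then show ?thesis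
          using abel[OF SS[OF that(1,2)]] lie_algebraD(3)[OF lie, of s t x] by simp
      qed
      show "\<exists>k. \<forall>x\<in>L j. (br s ^^ k) x = 0" if "s \<in> S" for s using nil[OF that] LN[of j] by blast
    qed (rule L_inv)
    then obtain L' where L': "subspace L'" "L' \<subset> L j" "\<And>s x. s \<in> S \<Longrightarrow> x \<in> L j \<Longrightarrow> br s x \<in> L'"
      by blast
    have "br x y \<in> L'" if "x \<in> S \<union> N" "y \<in> L j" for x y
      using that L'(3) abel[of x y] LN[of j] subspace_0[OF L'(1)] by auto
    then have "br x y \<in> L'" if "x \<in> ?M" "y \<in> L j" for x y
      using bilinear_span_mem[OF br L'(1) _ that(1) span_base[OF that(2)]] by blast
    then have "L (Suc j) \<subseteq> L'"
      unfolding L_Suc bracket_span_def using L'(1) by (intro span_minimal) auto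
    then have "dim (L (Suc j)) \<le> dim L'" by (rule dim_subset)
    also have "dim L' < dim (L j)"
      using L' Lsub[of j] by (metis dim_subset le_neq_implies_less order_refl psubset_eq subspace_dim_equal)
    finally show ?thesis .
  qed
  have "\<exists>j. L j = {0}"
  proof (rule ccontr)
    assume "\<nexists>j. L j = {0}"
    then have *: "dim (L (Suc j)) < dim (L j)" for j using decrease by blast
    have "dim (L j) + j \<le> dim (L 0)" for j
    proof (induction j)
      case (Suc j)
      then show ?case using *[of j] by linarith
    qed simp
    from this[of "Suc (dim (L 0))"] show False by simp
  qed
  then show ?thesis unfolding nilpotent_sub_def L_def by blast
qed

text \<open>Maximality of the nilradical as a membership criterion: brackets acting nilpotently on
  \<open>N\<close> are absorbed by it.\<close>

lemma nilpotent_action_subset_nilradical: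
  assumes "lie_algebra br" "is_nilradical br N" "abelian_sub br N" "lie_ideal br (span (S \<union> N))"
    and "\<And>s t. s \<in> S \<Longrightarrow> t \<in> S \<Longrightarrow> br s t \<in> N"
    and "\<And>s. s \<in> S \<Longrightarrow> \<exists>k. \<forall>v\<in>N. (br s ^^ k) v = 0"
  shows "S \<subseteq> N"
proof -
  have "nilpotent_sub br (span (S \<union> N))"
    using assms by (intro nilpotent_sub_span_nilpotent_action) (auto simp: is_nilradical_def)
  then have "span (S \<union> N) \<subseteq> N" using assms by (auto simp: is_nilradical_def)
  then show ?thesis using span_superset[of "S \<union> N"] by blast
qed

text \<open>Jacobson's lemma for the actions of \<open>T\<close> and \<open>X\<close> on
  \<open>N\<close>: as \<open>br T (br T X)\<close> acts as zero there, \<open>br T\<close> commutes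
  with the action of \<open>br T X\<close>. The projection extends these actions from
  \<open>N\<close> to the whole space.\<close>

lemma bracket_action_nilpotent:
  fixes br :: "'a::euclidean_space \<Rightarrow> 'a \<Rightarrow> 'a"
  assumes lie: "lie_algebra br" and N: "lie_ideal br N"
    and comm: "\<And>v. v \<in> N \<Longrightarrow> br (br T (br T X)) v = 0"
  shows "\<exists>k. \<forall>v\<in>N. (br (br T X) ^^ k) v = 0"
proof -
  have NI: "\<And>x y. y \<in> N \<Longrightarrow> br x y \<in> N" using N by (auto simp: lie_ideal_def)
  obtain P where P: "is_projection P N"
    using exists_projection_onto[of N] N by (auto simp: lie_ideal_def)
  have lin: "linear (\<lambda>v. br x (P v))" for x
    using linear_compose[OF is_projectionD(1)[OF P], of "br x"] lie_algebraD(1)[OF lie]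
    by (simp add: bilinear_def o_def)
  have PN: "P v \<in> N" for v by (rule is_projectionD(2)[OF P])
  have id: "P (br x (P v)) = br x (P v)" for x v
    using is_projectionD(3)[OF P NI[OF PN]] .
  define R where "R v = br (br T X) (P v)" for v
  have "\<exists>k. \<forall>v. (R ^^ k) v = 0"
  proof (rule commutator_nilpotent[OF lin[of T] lin[of X]])
    show "R v = br T (P (br X (P v))) - br X (P (br T (P v)))" for v
      unfolding R_def id using lie_algebraD(3)[OF lie] by simp
    show "br T (P (R v)) = R (br T (P v))" for v
      unfolding R_def id using comm[OF PN, of v] lie_algebraD(3)[OF lie, of T "br T X" "P v"] by simp
  qed
  then obtain k where k: "\<And>v. (R ^^ k) v = 0" by blast
  have "(R ^^ j) v = (br (br T X) ^^ j) v \<and> (br (br T X) ^^ j) v \<in> N" if "v \<in> N" for j v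
    using that by (induction j) (auto simp: R_def NI is_projectionD(3)[OF P])
  then show ?thesis using k by metis
qed

lemma lie_ideal_derived_series:
  assumes "lie_algebra br"
  shows "lie_ideal br (derived_series br n)"
proof (induction n)
  case 0
  show ?case by (simp add: lie_ideal_def)
next
  case (Suc n)
  then show ?case using lie_ideal_bracket_span[OF assms] by simp
qed

text \<open>Let \<open>k\<close> be the first index at which the derived series lies in
  \<open>N\<close>, and suppose it is at least 2. The term \<open>a\<close> before it has [a,a] in
  \<open>N\<close>, so for \<open>t\<close> in \<open>a\<close> the element [t,[t,x]] acts as zero
  on \<open>N\<close>; Jacobson's lemma and maximality of \<open>N\<close> then put [a,g] into
  \<open>N\<close>. Consequently [x,[x,y]] lies in \<open>N\<close> for \<open>x\<close>,
  \<open>y\<close> in the preceding term \<open>b\<close>, and the same argument puts a = [b,b] into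
  \<open>N\<close>, against the choice of \<open>k\<close>.\<close>

lemma bracket_in_abelian_nilradical:
  fixes br :: "'a::euclidean_space \<Rightarrow> 'a \<Rightarrow> 'a"
  assumes lie: "lie_algebra br" and solv: "solvable_lie br"
    and nilrad: "is_nilradical br N" and abelian: "abelian_sub br N"
  shows "br x y \<in> N"
proof -
  note br = lie_algebraD(1)[OF lie] and anti = lie_algebraD(2)[OF lie] and jac = lie_algebraD(3)[OF lie]
  have N: "lie_ideal br N" using nilrad by (simp add: is_nilradical_def)
  have Nsub: "subspace N" and NI: "\<And>x y. y \<in> N \<Longrightarrow> br x y \<in> N" using N by (auto simp: lie_ideal_def)
  have abel: "br x y = 0" if "x \<in> N" "y \<in> N" for x y using abelian that by (auto simp: abelian_sub_def)
  have mem: "br x y \<in> derived_series br (Suc n)" if "x \<in> derived_series br n" "y \<in> derived_series br n" for x y n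
    using that by (auto simp: bracket_span_def intro!: span_base)
  obtain n where "derived_series br n = {0}" using solv by (auto simp: solvable_lie_def)
  then have ex: "derived_series br n \<subseteq> N" using subspace_0[OF Nsub] by simp
  define k where "k = (LEAST k. derived_series br k \<subseteq> N)"
  have k: "derived_series br k \<subseteq> N" unfolding k_def using ex by (rule LeastI)
  have least: "\<not> derived_series br j \<subseteq> N" if "j < k" for j
    using not_less_Least that unfolding k_def by blast
  consider "k = 0" | "k = 1" | m where "k = Suc (Suc m)"
    by (metis One_nat_def not0_implies_Suc)
  then show ?thesis
  proof cases
    case 1
    then show ?thesis using k by auto
  next
    case 2
    then show ?thesis using k mem[of x 0 y] by auto
  next
    case (3 m)
    define a b where "a = derived_series br (Suc m)" and "b = derived_series br m"
    have a: "lie_ideal br a" and b: "lie_ideal br b"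
      using lie_ideal_derived_series[OF lie] by (auto simp: a_def b_def simp del: derived_series.simps)
    have aa: "br s t \<in> N" if "s \<in> a" "t \<in> a" for s t
      using mem[of s "Suc m" t] that k 3 by (auto simp: a_def simp del: derived_series.simps)
    have aI: "br x s \<in> a" "br s x \<in> a" if "s \<in> a" for x s
    proof -
      show "br x s \<in> a" using a that by (simp add: lie_ideal_def)
      then show "br s x \<in> a" using a anti[of s x] by (simp add: lie_ideal_def subspace_neg)
    qed
    define S where "S = {br t x |t x. t \<in> a}"
    have Sa: "S \<subseteq> a" using aI by (auto simp: S_def)
    have "S \<subseteq> N"
    proof (rule nilpotent_action_subset_nilradical[OF lie nilrad abelian])
      show "lie_ideal br (span (S \<union> N))"
      proof (rule lie_ideal_span[OF br])
        fix z y assume "y \<in> S \<union> N"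
        then show "br z y \<in> span (S \<union> N)"
        proof
          assume "y \<in> S"
          then obtain t x where y: "y = br t x" "t \<in> a" by (auto simp: S_def)
          have "br z y = br (br z t) x + br t (br z x)" using jac[of z t x] y by simp
          moreover have "br (br z t) x \<in> S" "br t (br z x) \<in> S" using y aI by (auto simp: S_def)
          ultimately show ?thesis by (simp add: span_add span_base)
        next
          assume "y \<in> N"
          then show ?thesis using NI by (auto intro!: span_base)
        qed
      qed
      show "br s t \<in> N" if "s \<in> S" "t \<in> S" for s t using that Sa aa by blast
      show "\<exists>k. \<forall>v\<in>N. (br s ^^ k) v = 0" if "s \<in> S" for s
      proof -
        obtain t x where s: "s = br t x" "t \<in> a" using \<open>s \<in> S\<close> by (auto simp: S_def)
        then have "br t (br t x) \<in> N" using aa aI by blast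
        then show ?thesis unfolding s using abel by (intro bracket_action_nilpotent[OF lie N]) auto
      qed
    qed
    then have central: "br t x \<in> N" "br x t \<in> N" if "t \<in> a" for t x
    proof -
      show "br t x \<in> N" using that \<open>S \<subseteq> N\<close> by (auto simp: S_def)
      then show "br x t \<in> N" using anti[of x t] Nsub by (simp add: subspace_neg)
    qed
    define S' where "S' = {br x y |x y. x \<in> b \<and> y \<in> b}"
    have a_eq: "a = span S'" by (simp add: a_def b_def S'_def bracket_span_def)
    have S'a: "S' \<subseteq> a" unfolding a_eq by (rule span_superset)
    have "S' \<subseteq> N"
    proof (rule nilpotent_action_subset_nilradical[OF lie nilrad abelian])
      show "lie_ideal br (span (S' \<union> N))"
      proof (rule lie_ideal_span[OF br])
        fix z y assume "y \<in> S' \<union> N"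
        then have "br z y \<in> N" using central S'a NI by blast
        then show "br z y \<in> span (S' \<union> N)" by (auto intro: span_base)
      qed
      show "br s t \<in> N" if "s \<in> S'" "t \<in> S'" for s t using that S'a aa by blast
      show "\<exists>k. \<forall>v\<in>N. (br s ^^ k) v = 0" if "s \<in> S'" for s
      proof -
        obtain x y where s: "s = br x y" using \<open>s \<in> S'\<close> by (auto simp: S'_def)
        then have "br x (br x y) \<in> N" using central S'a \<open>s \<in> S'\<close> by blast
        then show ?thesis unfolding s using abel by (intro bracket_action_nilpotent[OF lie N]) auto
      qed
    qed
    then have "a \<subseteq> N" unfolding a_eq using Nsub by (rule span_minimal)
    then show ?thesis using least[of "Suc m"] 3 by (simp add: a_def)
  qed
qed

section \<open>Geodesic bases\<close>

theorem theorem1p1: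
  fixes br :: "'a::euclidean_space \<Rightarrow> 'a \<Rightarrow> 'a" and N :: "'a set"
  assumes "lie_algebra br"
    and "unimodular br"
    and "solvable_lie br"
    and "is_nilradical br N"
    and "abelian_sub br N"
  shows "\<exists>ip. inner_product_on ip \<and> (\<exists>B. geodesic_basis ip br B)"
proof -
  note br = lie_algebraD(1)[OF assms(1)] and anti = lie_algebraD(2)[OF assms(1)]
    and jac = lie_algebraD(3)[OF assms(1)]
  have N: "subspace N" and NI: "\<And>x y. y \<in> N \<Longrightarrow> br x y \<in> N"
    using assms(4) by (auto simp: is_nilradical_def lie_ideal_def)
  have brN: "br x y \<in> N" for x y
    by (rule bracket_in_abelian_nilradical[OF assms(1,3-5)])
  have lin: "linear (br x)" for x using br by (simp add: bilinear_def)
  have "commuting_family N br"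
    unfolding commuting_family_def
  proof (intro conjI allI ballI N lin NI)
    fix x y v assume "v \<in> N"
    then have "br (br x y) v = 0" using assms(5) brN by (auto simp: abelian_sub_def)
    then show "br x (br y v) = br y (br x v)" using jac[of x y v] by simp
  qed
  then obtain f B where f: "inner_on N f" and B: "unit_spanning f N B"
    and balanced: "\<And>x e. e \<in> B \<Longrightarrow> f e (br x e) * trace_on N (\<lambda>x. x) = trace_on N (br x)"
    using commuting_family_balanced by blast
  obtain P where P: "is_projection P N" using exists_projection_onto[OF N] by blast
  note Pl = is_projectionD(1)[OF P] and PN = is_projectionD(2)[OF P] and Pid = is_projectionD(3)[OF P]
  \<comment> \<open>Since \<open>br x\<close> takes values in \<open>N\<close>, its trace on
    \<open>N\<close> is its trace on the whole algebra, which unimodularity makes zero.\<close>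
  have "trace_on N (br x) = 0" for x
  proof -
    have "trace_on N (br x) = trace_map (\<lambda>v. br x (P v))"
      by (rule trace_on_eq[OF P lin NI])
    also have "\<dots> = trace_map (\<lambda>v. P (br x v))" by (rule trace_map_commute[OF lin Pl])
    also have "\<dots> = 0" using assms(2) Pid[OF brN] by (simp add: unimodular_def)
    finally show ?thesis .
  qed
  \<comment> \<open>Division by the trace of the identity is allowed: the unit vector
    \<open>e\<close> in \<open>N\<close> rules out \<open>N = {0}\<close>.\<close>
  then have geod: "f e (br x e) = 0" if "e \<in> B" for x e
    using balanced[OF that, of x] trace_on_id_pos[OF N] that unit_spanningD[OF B]
      bilinear_lzero[OF inner_onD(1)[OF f]] by fastforce
  \<comment> \<open>\<open>N\<close> and the kernel of \<open>P\<close> become orthogonal; on the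
    kernel the Euclidean product is as good as any.\<close>
  define ip where "ip x y = f (P x) (P y) + (x - P x) \<bullet> (y - P y)" for x y
  have "inner_on {x \<in> UNIV. P x = 0} (\<bullet>)"
    by (auto simp: inner_on_def bilinear_def linear_iff inner_add_left inner_add_right inner_commute)
  from inner_on_glue[OF subspace_UNIV subset_UNIV P f this] have "inner_on UNIV ip"
    by (simp add: ip_def[abs_def])
  then have ip: "inner_product_on ip" by (simp add: inner_on_def inner_product_on_def)
  have ipN: "ip x y = f (P x) y" if "y \<in> N" for x y using Pid[OF that] by (simp add: ip_def)
  have "geodesic_element ip br e" if e: "e \<in> B" for e
  proof -
    have eN: "e \<in> N" and "f e e = 1" using e unit_spanningD[OF B] by auto
    have "e \<noteq> 0" using \<open>f e e = 1\<close> bilinear_lzero[OF inner_onD(1)[OF f]] by force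
    moreover have "ip e (br e y) = 0" for y
    proof -
      have "ip e (br e y) = f e (br e y)" using ipN[OF brN] Pid[OF eN] by simp
      also have "\<dots> = f e (- br y e)" using anti[of e y] by (rule arg_cong)
      also have "\<dots> = 0" using geod[OF e] by (simp add: bilinear_rneg[OF inner_onD(1)[OF f]])
      finally show ?thesis .
    qed
    ultimately show ?thesis by (simp add: geodesic_element_def)
  qed
  \<comment> \<open>All brackets lie in \<open>N\<close>, which is orthogonal to the kernel of
    \<open>P\<close>.\<close>
  moreover have "geodesic_element ip br x" if "P x = 0" "x \<noteq> 0" for x
    using that bilinear_lzero[OF inner_onD(1)[OF f]] by (simp add: geodesic_element_def ipN[OF brN])
  ultimately have all: "geodesic_element ip br x" if "x \<in> B \<union> {x. P x = 0 \<and> x \<noteq> 0}" for x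
    using that by blast
  let ?S = "B \<union> {x. P x = 0 \<and> x \<noteq> 0}"
  \<comment> \<open>Being geodesic concerns one vector at a time, so any basis extracted from a
    spanning set of geodesic elements will do.\<close>
  obtain E where E: "E \<subseteq> ?S" "independent E" "?S \<subseteq> span E"
    using maximal_independent_subset by blast
  have "x \<in> span E" for x
  proof -
    have "span B \<subseteq> span E" using E(3) by (intro span_minimal) auto
    then have "P x \<in> span E" using PN unit_spanningD(2)[OF B] by blast
    moreover have "x - P x \<in> span E"
    proof (cases "x - P x = 0")
      case True
      then show ?thesis by (simp only: span_zero)
    next
      case False
      then show ?thesis using E(3) Pid[OF PN] by (auto simp: linear_diff[OF Pl])
    qed
    ultimately have "P x + (x - P x) \<in> span E" by (rule span_add)
    then show ?thesis by simp
  qed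
  then have "geodesic_basis ip br E"
    using E all by (auto simp: geodesic_basis_def)
  then show ?thesis using ip by blast
qed

end
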